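(* Let $G$ be a finite, simple, connected graph that contains neither a house nor a hole as an induced subgraph, and let $n=|V(G)|$. Then, in the graph metric of $G$, either there is a universal line or there are at least $n$ distinct lines.
   Context: The house is the graph on five vertices obtained from a 5-cycle by adding one chord. A hole is a cycle on at least five vertices; "no induced hole" means no induced cycle of length at least 5. $d_G(u,v)$ denotes the shortest-path distance in $G$. A vertex $z$ is between $u$ and $v$ if $d_G(u,v)=d_G(u,z)+d_G(z,v)$; the interval $I(u,v)$ is the set of vertices between $u$ and $v$ (it contains $u$ and $v$). For two distinct vertices $u,v$, the line $\overline{uv}$ is the set of all vertices $z$ such that one of $u,v,z$ is between the other two. A line is universal if it equals $V(G)$.
   Formalization: The formal theorem assumes n ≥ 2: for the one-vertex graph there are no two distinct vertices, hence no lines at all, so the statement fails for n = 1. *)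

theory Defs
  imports Main
begin

text \<open>A simple graph is a vertex set \<open>V\<close> with a symmetric irreflexive adjacency relation \<open>E\<close> on it;
  each undirected edge occurs in \<open>E\<close> in both orientations.\<close>

definition simple_graph :: "'a set \<Rightarrow> 'a rel \<Rightarrow> bool" where
  "simple_graph V E \<longleftrightarrow> E \<subseteq> V \<times> V \<and> sym E \<and> irrefl E"

definition connected_graph :: "'a set \<Rightarrow> 'a rel \<Rightarrow> bool" where
  "connected_graph V E \<longleftrightarrow> (\<forall>u\<in>V. \<forall>v\<in>V. (u, v) \<in> E\<^sup>*)"

definition contains_induced :: "'a set \<Rightarrow> 'a rel \<Rightarrow> 'b set \<Rightarrow> 'b rel \<Rightarrow> bool" where
  "contains_induced V E W F \<longleftrightarrow>
     (\<exists>f. inj_on f W \<and> f ` W \<subseteq> V \<and> (\<forall>x\<in>W. \<forall>y\<in>W. (x, y) \<in> F \<longleftrightarrow> (f x, f y) \<in> E))"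

text \<open>The cycle on the vertices \<open>{..<k}\<close>; it is only used for \<open>k \<ge> 5\<close>.\<close>

definition cycle_edges :: "nat \<Rightarrow> nat rel" where
  "cycle_edges k = {(i, j). i < k \<and> j < k \<and> (j = Suc i mod k \<or> i = Suc j mod k)}"

definition house_edges :: "nat rel" where
  "house_edges = cycle_edges 5 \<union> {(0, 2), (2, 0)}"

definition has_induced_house :: "'a set \<Rightarrow> 'a rel \<Rightarrow> bool" where
  "has_induced_house V E \<longleftrightarrow> contains_induced V E {..<5} house_edges"

definition has_induced_hole :: "'a set \<Rightarrow> 'a rel \<Rightarrow> bool" where
  "has_induced_hole V E \<longleftrightarrow> (\<exists>k\<ge>5. contains_induced V E {..<k} (cycle_edges k))"

text \<open>\<open>E ^^ k\<close> relates the endpoints of walks with \<open>k\<close> edges, so the least such \<open>k\<close> is the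
  shortest-path distance. The value is unspecified for vertices in different components.\<close>

definition graph_dist :: "'a rel \<Rightarrow> 'a \<Rightarrow> 'a \<Rightarrow> nat" where
  "graph_dist E u v = (LEAST k. (u, v) \<in> E ^^ k)"

definition between :: "'a rel \<Rightarrow> 'a \<Rightarrow> 'a \<Rightarrow> 'a \<Rightarrow> bool" where
  "between E z u v \<longleftrightarrow> graph_dist E u v = graph_dist E u z + graph_dist E z v"

definition graph_line :: "'a set \<Rightarrow> 'a rel \<Rightarrow> 'a \<Rightarrow> 'a \<Rightarrow> 'a set" where
  "graph_line V E u v = {z \<in> V. between E z u v \<or> between E u z v \<or> between E v u z}"

definition graph_lines :: "'a set \<Rightarrow> 'a rel \<Rightarrow> 'a set set" where
  "graph_lines V E = {graph_line V E u v | u v. u \<in> V \<and> v \<in> V \<and> u \<noteq> v}"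

end

theory Submission
  imports Defs
begin

text \<open>
  Let \<open>r\<close> and \<open>s\<close> be at maximum distance, with the component \<open>C\<close> of \<open>r\<close> in the graph minus the closed
  neighbourhood of \<open>s\<close> as large as possible. Let \<open>S\<close> be the set of neighbours of \<open>C\<close> and \<open>A\<close> the
  remaining vertices. By maximality \<open>A\<close> is complete to \<open>S\<close>, so all vertices of \<open>A\<close> have the same
  distances to \<open>S \<union> C\<close>.

  Assume that there is no universal line. The lines \<open>ac\<close> with \<open>a \<in> A\<close> and \<open>c \<in> C\<close> are then pairwise distinct:
  if \<open>sc = sc'\<close> and \<open>c\<close> lies between \<open>s\<close> and \<open>c'\<close>, then \<open>c\<close> is a cut vertex and \<open>cc'\<close> is universal;
  the case of \<open>s\<close> between \<open>c\<close> and \<open>c'\<close> contradicts the choice of \<open>r\<close> and \<open>s\<close> or the connectedness of \<open>C\<close>.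
  The lines \<open>sx\<close> with \<open>x \<in> S\<close> can coincide, but vertices \<open>x \<noteq> x'\<close> with \<open>sx = sx'\<close> are nonadjacent and
  generate a line \<open>xx'\<close>. Up to explicitly described coincidences, where a third line is used instead,
  this gives \<open>|S|\<close> further lines (one less if some \<open>sx\<close> equals some \<open>sc\<close>), and one more line is always
  available. Since \<open>|A| |C| + 1 \<ge> |A| + |C|\<close>, this makes \<open>n\<close> lines; in the exceptional case \<open>|A|\<close> and \<open>|C|\<close>
  are at least two and \<open>|A| |C| \<ge> |A| + |C|\<close>.

  Houses and holes enter only through \<open>common_neighbour\<close>; it implies the triangle and the quadrangle
  condition of weakly modular graphs, on which all distance arguments rest.
\<close>


section \<open>Recognising induced holes and houses\<close>

lemma induced_holeI:
  assumes sg: "simple_graph V E" and k: "k \<ge> 5"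
    and inV: "\<And>i. i < k \<Longrightarrow> f i \<in> V"
    and inj: "\<And>i j. i < j \<Longrightarrow> j < k \<Longrightarrow> f i \<noteq> f j"
    and adj: "\<And>i j. i < j \<Longrightarrow> j < k \<Longrightarrow> (f i, f j) \<in> E \<longleftrightarrow> j = Suc i \<or> (i = 0 \<and> Suc j = k)"
  shows "has_induced_hole V E"
proof -
  have symE: "(x, y) \<in> E \<longleftrightarrow> (y, x) \<in> E" for x y
    using sg by (auto simp: simple_graph_def sym_def)
  have irr: "(x, x) \<notin> E" for x
    using sg by (auto simp: simple_graph_def irrefl_def)
  have cyc: "(i, j) \<in> cycle_edges k \<longleftrightarrow> j = Suc i \<or> (i = 0 \<and> Suc j = k)" if "i < j" "j < k" for i j
    using that k by (auto simp: cycle_edges_def mod_Suc)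
  have cycsym: "(i, j) \<in> cycle_edges k \<longleftrightarrow> (j, i) \<in> cycle_edges k" for i j
    by (auto simp: cycle_edges_def)
  have cycirr: "(i, i) \<notin> cycle_edges k" for i
    using k by (auto simp: cycle_edges_def mod_Suc)
  have "(i, j) \<in> cycle_edges k \<longleftrightarrow> (f i, f j) \<in> E" if "i < k" "j < k" for i j
  proof (cases i j rule: linorder_cases)
    case less then show ?thesis using cyc adj that by blast
  next
    case equal then show ?thesis using cycirr irr by simp
  next
    case greater then show ?thesis using cyc adj that cycsym symE by meson
  qed
  moreover have "inj_on f {..<k}"
    using inj by (metis inj_onI lessThan_iff linorder_neqE_nat)
  ultimately show ?thesis
    using k inV unfolding has_induced_hole_def contains_induced_def by blast
qed

text \<open>The vertex \<open>b\<close> is the roof: the 5-cycle is \<open>a b c p q\<close>, and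
  the chord joins the two neighbours of \<open>b\<close>.\<close>

lemma induced_houseI:
  assumes sg: "simple_graph V E"
    and "(a, b) \<in> E" "(b, c) \<in> E" "(c, p) \<in> E" "(p, q) \<in> E" "(q, a) \<in> E" "(a, c) \<in> E"
    and "(a, p) \<notin> E" "(b, p) \<notin> E" "(b, q) \<notin> E" "(c, q) \<notin> E"
  shows "has_induced_house V E"
proof -
  have symE: "(x, y) \<in> E \<longleftrightarrow> (y, x) \<in> E" for x y
    using sg by (auto simp: simple_graph_def sym_def)
  have irr: "(x, x) \<notin> E" for x
    using sg by (auto simp: simple_graph_def irrefl_def)
  have inV: "a \<in> V" "b \<in> V" "c \<in> V" "p \<in> V" "q \<in> V"
    using assms by (auto simp: simple_graph_def)
  let ?f = "\<lambda>i::nat. if i = 0 then a else if i = 1 then b else if i = 2 then c else if i = 3 then p else q"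
  have set5: "{..<5::nat} = {0, 1, 2, 3, 4}" by auto
  have ne: "a \<noteq> b" "a \<noteq> c" "a \<noteq> p" "a \<noteq> q" "b \<noteq> c" "b \<noteq> p" "b \<noteq> q" "c \<noteq> p" "c \<noteq> q" "p \<noteq> q"
    using assms irr symE by metis+
  have "inj_on ?f {..<5}"
    unfolding set5 using ne by (auto simp: inj_on_def)
  moreover have "?f ` {..<5} \<subseteq> V" using inV by auto
  moreover have "\<forall>x\<in>{..<5}. \<forall>y\<in>{..<5}. (x, y) \<in> house_edges \<longleftrightarrow> (?f x, ?f y) \<in> E"
    unfolding set5 using assms irr symE[of b a] symE[of c b] symE[of p c] symE[of q p] symE[of a q]
      symE[of c a] symE[of p a] symE[of p b] symE[of q b] symE[of q c]
    by (auto simp: house_edges_def cycle_edges_def)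
  ultimately show ?thesis
    unfolding has_induced_house_def contains_induced_def by blast
qed

section \<open>Graph distance and lines\<close>

locale conn_graph =
  fixes V :: "'a set" and E :: "'a rel"
  assumes fin: "finite V" and sg: "simple_graph V E" and cg: "connected_graph V E"
begin

abbreviation adj :: "'a \<Rightarrow> 'a \<Rightarrow> bool" (infix "\<approx>" 50) where "u \<approx> v \<equiv> (u, v) \<in> E"
abbreviation d :: "'a \<Rightarrow> 'a \<Rightarrow> nat" where "d \<equiv> graph_dist E"
abbreviation ln :: "'a \<Rightarrow> 'a \<Rightarrow> 'a set" where "ln \<equiv> graph_line V E"

lemma adj_sym: "u \<approx> v \<longleftrightarrow> v \<approx> u"
  using sg by (auto simp: simple_graph_def sym_def)

lemma adj_irrefl [simp]: "\<not> u \<approx> u"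
  using sg by (auto simp: simple_graph_def irrefl_def)

lemma adj_inV: "u \<approx> v \<Longrightarrow> u \<in> V" "u \<approx> v \<Longrightarrow> v \<in> V"
  using sg by (auto simp: simple_graph_def)

lemma d_walk: "u \<in> V \<Longrightarrow> v \<in> V \<Longrightarrow> (u, v) \<in> E ^^ d u v"
  using cg unfolding connected_graph_def graph_dist_def rtrancl_power
  by (metis LeastI_ex)

lemma d_le: "(u, v) \<in> E ^^ k \<Longrightarrow> d u v \<le> k"
  unfolding graph_dist_def by (rule Least_le)

lemma d_self [simp]: "d u u = 0"
  using d_le[of u u 0] by simp

lemma relpow_sym: "(u, v) \<in> E ^^ k \<Longrightarrow> (v, u) \<in> E ^^ k"
proof (induction k arbitrary: v)
  case (Suc k)
  then obtain w where "(u, w) \<in> E ^^ k" "w \<approx> v" by auto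
  then show ?case using Suc.IH adj_sym by (meson relpow_Suc_I2)
qed simp

lemma d_sym: "u \<in> V \<Longrightarrow> v \<in> V \<Longrightarrow> d u v = d v u"
  using d_walk d_le relpow_sym by (metis le_antisym)

lemma d_eq_0: "u \<in> V \<Longrightarrow> v \<in> V \<Longrightarrow> d u v = 0 \<longleftrightarrow> u = v"
  using d_walk[of u v] by auto

lemma d_tri: "u \<in> V \<Longrightarrow> v \<in> V \<Longrightarrow> w \<in> V \<Longrightarrow> d u w \<le> d u v + d v w"
  using d_walk[of u v] d_walk[of v w] by (intro d_le) (auto simp: relpow_add)

lemma d_eq_1: "u \<in> V \<Longrightarrow> v \<in> V \<Longrightarrow> d u v = 1 \<longleftrightarrow> u \<approx> v"
proof
  assume V: "u \<in> V" "v \<in> V"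
  show "u \<approx> v" if "d u v = 1" using d_walk[OF V] that by simp
  assume a: "u \<approx> v"
  then have "d u v \<le> 1" by (intro d_le) simp
  moreover have "d u v \<noteq> 0" using a d_eq_0[OF V] by auto
  ultimately show "d u v = 1" by simp
qed

lemma adj_d1: "u \<approx> v \<Longrightarrow> d u v = 1"
  using d_eq_1 adj_inV by blast

lemma d_adj: "u \<approx> v \<Longrightarrow> z \<in> V \<Longrightarrow> d z u \<le> d z v + 1"
  using d_tri[of z v u] adj_inV adj_d1[of v u] adj_sym by fastforce

lemma d_adj': "u \<approx> v \<Longrightarrow> z \<in> V \<Longrightarrow> d u z \<le> d v z + 1"
  using d_adj d_sym adj_inV by metis

lemma d_pred:
  assumes "u \<in> V" "v \<in> V" "d u v = Suc k"
  obtains w where "w \<approx> v" "d u w = k"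
proof -
  obtain w where w: "(u, w) \<in> E ^^ k" "w \<approx> v"
    using d_walk[OF assms(1,2)] assms(3) by auto
  have "d u w \<le> k" using d_le w by blast
  moreover have "Suc k \<le> d u w + 1"
    using d_adj[of v w u] w adj_sym assms by auto
  ultimately show ?thesis using that w by auto
qed

lemma d_le_2: "u \<approx> w \<Longrightarrow> w \<approx> v \<Longrightarrow> d u v \<le> 2"
  using d_adj[of v w u] adj_d1[of u w] adj_sym[of w v] adj_inV by fastforce

lemma d_eq_2: "u \<approx> w \<Longrightarrow> w \<approx> v \<Longrightarrow> u \<noteq> v \<Longrightarrow> \<not> u \<approx> v \<Longrightarrow> d u v = 2"
  using d_le_2[of u w v] d_eq_0[of u v] d_eq_1[of u v] adj_inV[of u w] adj_inV[of w v]
  by (cases "d u v" rule: nat.exhaust) (auto simp: numeral_2_eq_2 le_Suc_eq)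

section \<open>Connected vertex sets and induced paths through them\<close>

definition conn :: "'a set \<Rightarrow> bool" where
  "conn Y \<longleftrightarrow> (\<forall>y\<in>Y. \<forall>y'\<in>Y. (y, y') \<in> (E \<inter> Y \<times> Y)\<^sup>*)"

lemma conn_hubI:
  assumes "h \<in> Y" "\<And>y. y \<in> Y \<Longrightarrow> (y, h) \<in> (E \<inter> Y \<times> Y)\<^sup>*"
  shows "conn Y"
proof -
  have "sym (E \<inter> Y \<times> Y)" using adj_sym by (auto simp: sym_def)
  then have "sym ((E \<inter> Y \<times> Y)\<^sup>*)" by (rule sym_rtrancl)
  then show ?thesis unfolding conn_def using assms(2)
    by (meson rtrancl_trans symD)
qed

lemma conn_single: "conn {a}"
  by (simp add: conn_def)

lemma conn_insert:
  assumes "conn Y" "y \<in> Y" "x \<approx> y"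
  shows "conn (insert x Y)"
proof (rule conn_hubI)
  let ?R = "E \<inter> insert x Y \<times> insert x Y"
  show "y \<in> insert x Y" using assms by simp
  have mono: "(E \<inter> Y \<times> Y)\<^sup>* \<subseteq> ?R\<^sup>*" by (intro rtrancl_mono) auto
  fix z assume "z \<in> insert x Y"
  then consider "z = x" | "z \<in> Y" by auto
  then show "(z, y) \<in> ?R\<^sup>*"
  proof cases
    case 1 then show ?thesis using assms by auto
  next
    case 2 then show ?thesis using assms mono by (auto simp: conn_def)
  qed
qed

lemma conn_ball: "z \<in> V \<Longrightarrow> conn {y \<in> V. d z y \<le> k}"
proof (rule conn_hubI)
  let ?Y = "{y \<in> V. d z y \<le> k}"
  assume z: "z \<in> V"
  then show "z \<in> ?Y" by simp
  have "\<lbrakk>y \<in> V; d z y \<le> k\<rbrakk> \<Longrightarrow> (y, z) \<in> (E \<inter> ?Y \<times> ?Y)\<^sup>*" for y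
  proof (induction "d z y" arbitrary: y)
    case 0 then show ?case using d_eq_0 z by auto
  next
    case (Suc m)
    obtain w where w: "w \<approx> y" "d z w = m" using d_pred z Suc by metis
    then have "(w, z) \<in> (E \<inter> ?Y \<times> ?Y)\<^sup>*" using Suc adj_inV by auto
    moreover have "(y, w) \<in> E \<inter> ?Y \<times> ?Y" using w Suc adj_inV adj_sym by auto
    ultimately show ?case by (rule converse_rtrancl_into_rtrancl[rotated])
  qed
  then show "\<And>y. y \<in> ?Y \<Longrightarrow> (y, z) \<in> (E \<inter> ?Y \<times> ?Y)\<^sup>*" by auto
qed

text \<open>In a shortest walk from \<open>u\<close> to \<open>v\<close> with nonempty interior
  inside \<open>Y\<close>, a repetition or a chord would give a shorter such walk. The pair of ends
  is exempt, since the edge \<open>uv\<close> alone has no interior vertex.\<close>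

lemma shortest_path_through:
  assumes Y: "conn Y" "Y \<subseteq> V" and u: "u \<notin> Y" "u \<approx> y" "y \<in> Y" and v: "v \<notin> Y" "v \<approx> y'" "y' \<in> Y"
    and uv: "u \<noteq> v"
  obtains m b where "m \<ge> 2" "b 0 = u" "b m = v" "\<And>i. i < m \<Longrightarrow> b i \<approx> b (Suc i)"
    "\<And>i. 0 < i \<Longrightarrow> i < m \<Longrightarrow> b i \<in> Y"
    "\<And>i j. i < j \<Longrightarrow> j \<le> m \<Longrightarrow> b i \<noteq> b j"
    "\<And>i j. Suc i < j \<Longrightarrow> j \<le> m \<Longrightarrow> \<not> (i = 0 \<and> j = m) \<Longrightarrow> \<not> b i \<approx> b j"
proof -
  define P where "P m b \<longleftrightarrow> m \<ge> 2 \<and> b 0 = u \<and> b m = v \<and> (\<forall>i<m. b i \<approx> b (Suc i)) \<and> (\<forall>i. 0 < i \<longrightarrow> i < m \<longrightarrow> b i \<in> Y)"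
    for m :: nat and b
  obtain k where "(y, y') \<in> (E \<inter> Y \<times> Y) ^^ k"
    using Y u v unfolding conn_def rtrancl_power by blast
  then obtain f where f: "f 0 = y" "f k = y'" "\<And>i. i < k \<Longrightarrow> (f i, f (Suc i)) \<in> E \<inter> Y \<times> Y"
    unfolding relpow_fun_conv by blast
  have fY: "f i \<in> Y" if "i \<le> k" for i
    using that f u v by (cases "i = k") (auto simp: le_less)
  \<comment> \<open>The walk \<open>f\<close> inside \<open>Y\<close>, shifted by one, with
    \<open>u\<close> and \<open>v\<close> attached at its ends.\<close>
  let ?g = "\<lambda>i. if i = 0 then u else if i \<le> Suc k then f (i - 1) else v"
  have "P (Suc (Suc k)) ?g"
    unfolding P_def
  proof (intro conjI allI impI)
    fix i assume i: "i < Suc (Suc k)"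
    consider "i = 0" | "0 < i" "i \<le> k" | "i = Suc k" using i by linarith
    then show "?g i \<approx> ?g (Suc i)"
    proof cases
      case 2 then show ?thesis using f(3)[of "i - 1"] by auto
    qed (use f u v adj_sym in auto)
  qed (use fY in auto)
  then have ex: "\<exists>m b. P m b" by blast
  define m where "m = (LEAST m. \<exists>b. P m b)"
  have "\<exists>b. P m b" unfolding m_def by (rule LeastI_ex[OF ex])
  then obtain b where Pb: "P m b" by blast
  have least: "\<not> P m' b'" if "m' < m" for m' b'
    using not_less_Least[of m' "\<lambda>m. \<exists>b. P m b"] that unfolding m_def by blast
  have b: "m \<ge> 2" "b 0 = u" "b m = v" "\<And>i. i < m \<Longrightarrow> b i \<approx> b (Suc i)" "\<And>i. 0 < i \<Longrightarrow> i < m \<Longrightarrow> b i \<in> Y"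
    using Pb unfolding P_def by auto
  have inj: "b i \<noteq> b j" if ij: "i < j" "j \<le> m" for i j
  proof
    assume eq: "b i = b j"
    \<comment> \<open>A repetition involves neither end, so cutting it out keeps both ends and an
      interior vertex between them.\<close>
    have i0: "0 < i"
    proof (rule ccontr)
      assume "\<not> 0 < i"
      then have "b j = u" using eq b by simp
      then show False using b ij u(1) uv by (cases "j = m") auto
    qed
    have jm: "j < m"
    proof (rule ccontr)
      assume "\<not> j < m"
      then have "b i = v" using eq b ij by simp
      moreover have "b i \<in> Y" using b ij i0 by auto
      ultimately show False using v(1) by simp
    qed
    let ?c = "\<lambda>k. if k \<le> i then b k else b (k + (j - i))"
    have "P (m - (j - i)) ?c"
      unfolding P_def
    proof (intro conjI allI impI)
      fix k assume k: "k < m - (j - i)"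
      show "?c k \<approx> ?c (Suc k)"
      proof (cases k i rule: linorder_cases)
        case less then show ?thesis using b ij by auto
      next
        case equal
        then have "b j \<approx> b (Suc j)" using b jm by auto
        then show ?thesis using equal eq ij by simp
      next
        case greater
        then have "b (k + (j - i)) \<approx> b (Suc (k + (j - i)))" using b k by auto
        then show ?thesis using greater by simp
      qed
    qed (use b ij i0 jm in auto)
    moreover have "m - (j - i) < m" using ij by linarith
    ultimately show False using least by blast
  qed
  have ind: "\<not> b i \<approx> b j" if ij: "Suc i < j" "j \<le> m" "\<not> (i = 0 \<and> j = m)" for i j
  proof
    assume e: "b i \<approx> b j"
    \<comment> \<open>The chord replaces \<open>j - i\<close> edges by one.\<close>
    let ?e = "j - i - 1"
    let ?c = "\<lambda>k. if k \<le> i then b k else b (k + ?e)"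
    have "P (m - ?e) ?c"
      unfolding P_def
    proof (intro conjI allI impI)
      fix k assume k: "k < m - ?e"
      show "?c k \<approx> ?c (Suc k)"
      proof (cases k i rule: linorder_cases)
        case less then show ?thesis using b ij by auto
      next
        case equal then show ?thesis using e ij by simp
      next
        case greater
        then have "b (k + ?e) \<approx> b (Suc (k + ?e))" using b k by auto
        then show ?thesis using greater by simp
      qed
    qed (use b ij in auto)
    moreover have "m - ?e < m" using ij by linarith
    ultimately show False using least by blast
  qed
  show ?thesis
    by (rule that[of m b]) (use b inj ind in auto)
qed

lemma mem_line: "z \<in> ln u v \<longleftrightarrow> z \<in> V \<and> (d u v = d u z + d z v \<or> d z v = d z u + d u v \<or> d u z = d u v + d v z)"
  by (auto simp: graph_line_def between_def)

lemma ln_sym: "u \<in> V \<Longrightarrow> v \<in> V \<Longrightarrow> ln u v = ln v u"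
  unfolding graph_line_def between_def using d_sym by (auto; metis add.commute)

text \<open>The distances from \<open>z\<close> to the ends of an edge differ by at most one, and if
  they differ, the closer end is between \<open>z\<close> and the other.\<close>

lemma edge_line: "u \<approx> v \<Longrightarrow> z \<in> ln u v \<longleftrightarrow> z \<in> V \<and> d u z \<noteq> d v z"
  using d_adj'[of u v z] d_adj'[of v u z] adj_sym[of u v] adj_d1[of u v] adj_inV[of u v] d_sym[of u z] d_sym[of v z]
    d_eq_0[of u z] d_eq_0[of v z]
  by (auto simp: mem_line)

end

section \<open>Weak modularity\<close>

locale hh_free = conn_graph +
  assumes no_house: "\<not> has_induced_house V E" and no_hole: "\<not> has_induced_hole V E"
begin

text \<open>Otherwise a shortest path from \<open>u\<close> to \<open>v\<close> through
  \<open>Y\<close> has at least three edges. If \<open>u\<close> and \<open>v\<close> are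
  nonadjacent, \<open>w\<close> closes it to a hole. If they are adjacent, a path with three edges
  gives a house with roof \<open>w\<close>, and a longer one is closed to a hole by the edge
  \<open>uv\<close>.\<close>

lemma common_neighbour:
  assumes Y: "conn Y" "Y \<subseteq> V" and w: "w \<approx> u" "w \<approx> v" "u \<noteq> v" "\<And>y. y \<in> Y \<Longrightarrow> \<not> w \<approx> y"
    and u: "u \<approx> y0" "y0 \<in> Y" and v: "v \<approx> y1" "y1 \<in> Y"
  shows "\<exists>y\<in>Y. u \<approx> y \<and> v \<approx> y"
proof (rule ccontr)
  assume no: "\<not> ?thesis"
  have wY: "w \<notin> Y" using no w adj_sym by blast
  have uY: "u \<notin> Y" and vY: "v \<notin> Y" using w by auto
  obtain m b where m: "m \<ge> 2" and b: "b 0 = u" "b m = v" "\<And>i. i < m \<Longrightarrow> b i \<approx> b (Suc i)"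
    and bY: "\<And>i. 0 < i \<Longrightarrow> i < m \<Longrightarrow> b i \<in> Y"
    and inj: "\<And>i j. i < j \<Longrightarrow> j \<le> m \<Longrightarrow> b i \<noteq> b j"
    and ind: "\<And>i j. Suc i < j \<Longrightarrow> j \<le> m \<Longrightarrow> \<not> (i = 0 \<and> j = m) \<Longrightarrow> \<not> b i \<approx> b j"
    using shortest_path_through[OF Y uY u vY v w(3)] by blast
  have bV: "b i \<in> V" if "i \<le> m" for i
    using that b adj_inV(2)[OF w(1)] adj_inV(2)[OF w(2)] bY[of i] Y(2)
    by (cases "i = 0"; cases "i = m") auto
  have "m \<noteq> 2"
  proof
    assume "m = 2"
    then have "b 1 \<in> Y" "u \<approx> b 1" "v \<approx> b 1"
      using bY[of 1] b(1,2) b(3)[of 0] b(3)[of 1] adj_sym by (auto simp: numeral_2_eq_2)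
    then show False using no by blast
  qed
  then have m3: "m \<ge> 3" using m by simp
  show False
  proof (cases "u \<approx> v")
    case False
    let ?f = "\<lambda>i. if i \<le> m then b i else w"
    have "has_induced_hole V E"
    proof (rule induced_holeI[OF sg])
      show "5 \<le> m + 2" using m3 by simp
      show "?f i \<in> V" if "i < m + 2" for i using bV w adj_inV by auto
      fix i j :: nat assume ij: "i < j" "j < m + 2"
      have wb: "w \<approx> b i \<longleftrightarrow> i = 0 \<or> i = m" if "i \<le> m" for i
        using that w b bY[of i] by (cases "i = 0"; cases "i = m") auto
      have wne: "b i \<noteq> w" if "i \<le> m" for i
        using that w b bY[of i] wY by (cases "i = 0"; cases "i = m") auto
      show "?f i \<noteq> ?f j" using inj[of i j] wne[of i] ij by auto
      show "?f i \<approx> ?f j \<longleftrightarrow> j = Suc i \<or> (i = 0 \<and> Suc j = m + 2)"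
      proof (cases "j \<le> m")
        case True
        then show ?thesis using ij ind[of i j] b False
          by (cases "j = Suc i"; cases "i = 0 \<and> j = m") auto
      next
        case False
        then have "j = m + 1" using ij by simp
        then show ?thesis using wb[of i] ij adj_sym[of w "b i"] by auto
      qed
    qed
    then show False using no_hole by simp
  next
    case True
    show False
    proof (cases "m = 3")
      case True
      have e: "u \<approx> b 1" "b 1 \<approx> b 2" "b 2 \<approx> v"
        using b(1,2) b(3)[of 0] b(3)[of 1] b(3)[of 2] True by (auto simp: eval_nat_numeral)
      have n: "\<not> u \<approx> b 2" "\<not> b 1 \<approx> v"
        using ind[of 0 2] ind[of 1 3] b True by auto
      have n2: "\<not> w \<approx> b 1" "\<not> w \<approx> b 2" using w bY[of 1] bY[of 2] True by auto
      have "has_induced_house V E"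
        by (rule induced_houseI[OF sg, of u w v "b 2" "b 1"])
          (use e n n2 w \<open>u \<approx> v\<close> adj_sym in blast)+
      then show False using no_house by simp
    next
      case False
      have "has_induced_hole V E"
      proof (rule induced_holeI[OF sg])
        show "5 \<le> m + 1" using m3 False by simp
        show "b i \<in> V" if "i < m + 1" for i using bV that by auto
        fix i j :: nat assume ij: "i < j" "j < m + 1"
        show "b i \<noteq> b j" using inj ij by auto
        show "b i \<approx> b j \<longleftrightarrow> j = Suc i \<or> (i = 0 \<and> Suc j = m + 1)"
          using ij ind[of i j] b \<open>u \<approx> v\<close> by (cases "j = Suc i"; cases "i = 0 \<and> j = m") auto
      qed
      then show False using no_hole by simp
    qed
  qed
qed

text \<open>This is \<open>common_neighbour\<close> for the ball of radius \<open>k - 1\<close>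
  around \<open>z\<close>, which contains no neighbour of \<open>w\<close>. Unlike in the usual
  quadrangle condition, \<open>u\<close> and \<open>v\<close> may be adjacent.\<close>

lemma quadrangle:
  assumes z: "z \<in> V" and w: "w \<approx> u" "w \<approx> v" and uv: "u \<noteq> v"
    and du: "d z u = k" "d z v = k" "d z w = Suc k"
  obtains p where "p \<approx> u" "p \<approx> v" "Suc (d z p) = k"
proof -
  have V: "u \<in> V" "v \<in> V" "w \<in> V" using w adj_inV by auto
  have "k \<noteq> 0" using du uv d_eq_0 z V by metis
  then obtain l where l: "k = Suc l" using not0_implies_Suc by blast
  obtain p0 p1 where p: "p0 \<approx> u" "d z p0 = l" "p1 \<approx> v" "d z p1 = l"
    using d_pred[of z u l] d_pred[of z v l] z V du l by metis
  have "\<exists>p\<in>{y \<in> V. d z y \<le> l}. u \<approx> p \<and> v \<approx> p"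
  proof (rule common_neighbour[of _ w u v p0 p1])
    show "conn {y \<in> V. d z y \<le> l}" by (rule conn_ball[OF z])
    show "\<not> w \<approx> y" if "y \<in> {y \<in> V. d z y \<le> l}" for y
      using that d_adj[of w y z] z du l by auto
  qed (use p w uv z adj_sym adj_inV in auto)
  then obtain p where "p \<in> V" "d z p \<le> l" "u \<approx> p" "v \<approx> p" by blast
  then show ?thesis using that[of p] adj_sym[of u p] adj_sym[of v p] d_adj[of u p z] z du l by fastforce
qed

text \<open>Two configurations are covered at once: if \<open>a\<close> and \<open>b\<close> are
  adjacent, \<open>p\<close> would be the roof of a house, and otherwise \<open>p a e c b\<close>
  would be an induced 5-cycle.\<close>

lemma house_free:
  assumes "p \<approx> a" "p \<approx> b" "a \<noteq> b" "b \<approx> c" "a \<approx> e" "c \<approx> e" "\<not> a \<approx> c" "\<not> b \<approx> e"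
  shows "p \<approx> c \<or> p \<approx> e"
proof (rule ccontr)
  assume "\<not> ?thesis"
  then have "\<exists>y\<in>{c, e}. a \<approx> y \<and> b \<approx> y"
    using assms adj_inV conn_insert[OF conn_single, of e e c]
    by (intro common_neighbour[of _ p a b e c]) auto
  then show False using assms by auto
qed

text \<open>If predecessors \<open>p\<close> of \<open>u\<close> and \<open>q\<close> of
  \<open>v\<close> are not adjacent to the opposite end, they are adjacent to each other. The
  induction hypothesis for the edge \<open>pq\<close> then gives the roof of a house on
  \<open>u v q p\<close>.\<close>

lemma triangle:
  assumes z: "z \<in> V" and "u \<approx> v" "d z u = k" "d z v = k"
  obtains p where "p \<approx> u" "p \<approx> v" "Suc (d z p) = k"
proof -
  have "\<exists>p. p \<approx> u \<and> p \<approx> v \<and> Suc (d z p) = k"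
    using assms(2-)
  proof (induction k arbitrary: u v)
    case 0
    then show ?case using d_eq_0 z adj_inV by (metis adj_irrefl)
  next
    case (Suc k)
    have V: "u \<in> V" "v \<in> V" using Suc adj_inV by auto
    obtain p where p: "p \<approx> u" "d z p = k" using d_pred z V Suc.prems by metis
    obtain q where q: "q \<approx> v" "d z q = k" using d_pred z V Suc.prems by metis
    show ?case
    proof (cases "p \<approx> v \<or> q \<approx> u")
      case True then show ?thesis using p q Suc.prems by blast
    next
      case False
      have "p \<noteq> q" using False q by auto
      then obtain k' where k': "k = Suc k'"
        using p q d_eq_0 z adj_inV by (metis not0_implies_Suc)
      obtain p' where p': "p' \<approx> p" "d z p' = k'" using d_pred z p adj_inV k' by metis
      obtain q' where q': "q' \<approx> q" "d z q' = k'" using d_pred z q adj_inV k' by metis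
      let ?B = "{y \<in> V. d z y \<le> k'}"
      \<comment> \<open>The ball itself is too far from \<open>v\<close>, so after adding
        \<open>q\<close> the common neighbour can only be \<open>q\<close>.\<close>
      have "\<exists>y\<in>insert q ?B. p \<approx> y \<and> v \<approx> y"
      proof (rule common_neighbour[of _ u p v p' q])
        show "conn (insert q ?B)"
          using conn_insert[OF conn_ball[OF z], of q' k' q] q' adj_sym[of q' q] adj_inV[of q' q] by auto
        show "\<not> u \<approx> y" if "y \<in> insert q ?B" for y
          using that d_adj[of u y z] z Suc.prems k' False adj_sym[of u q] by auto
      qed (use p p' q False adj_sym adj_inV Suc.prems in auto)
      then obtain y where y: "y \<in> insert q ?B" "p \<approx> y" "v \<approx> y" by blast
      have "y = q" using y d_adj[of v y z] z Suc.prems k' by auto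
      then have pq: "p \<approx> q" using y by simp
      obtain e where e: "e \<approx> p" "e \<approx> q" "Suc (d z e) = k" using Suc.IH[OF pq p(2) q(2)] by blast
      have "e \<approx> u \<or> e \<approx> v"
        using house_free[of e p q v u] e pq p q False Suc.prems adj_sym[of p u] adj_sym[of q v]
          adj_sym[of v u] adj_sym[of q u] \<open>p \<noteq> q\<close> by auto
      then show ?thesis
        using d_adj[of u e z] d_adj[of v e z] adj_sym[of e u] adj_sym[of e v] z e Suc.prems by auto
    qed
  qed
  then show ?thesis using that by blast
qed

text \<open>A vertex equidistant from both ends would give a triangle on the edge by the triangle
  condition.\<close>

lemma triangle_free_edge_universal:
  assumes "u \<approx> v" "\<And>p. \<not> (p \<approx> u \<and> p \<approx> v)"
  shows "ln u v = V"
proof -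
  have "d u z \<noteq> d v z" if z: "z \<in> V" for z
  proof
    assume "d u z = d v z"
    then have "d z u = d z v" using z assms(1) adj_inV d_sym by metis
    then show False using triangle[OF z assms(1)] assms(2) by metis
  qed
  then show ?thesis using edge_line[OF assms(1)] by auto
qed

end


section \<open>Opposite vertices near an end of a diametral pair\<close>

context conn_graph
begin

lemma geodesic_point:
  assumes "u \<in> V" "v \<in> V" "k \<le> d u v"
  obtains w where "w \<in> V" "d u w = k" "d u v = k + d w v"
proof -
  have "\<exists>w\<in>V. d u w = k \<and> d u v = k + d w v" using assms
  proof (induction "d u v - k" arbitrary: v)
    case 0
    then show ?case by (intro bexI[of _ v]) auto
  next
    case (Suc m)
    then obtain l where l: "d u v = Suc l" by (metis Suc_diff_le diff_is_0_eq' not0_implies_Suc not_less_eq_eq le0 zero_less_diff)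
    then obtain p where p: "p \<approx> v" "d u p = l" using d_pred Suc.prems by metis
    have "m = d u p - k" "k \<le> d u p" using Suc.hyps(2) l p Suc.prems by auto
    then obtain w where w: "w \<in> V" "d u w = k" "d u p = k + d w p"
      using Suc.hyps(1)[of p] p adj_inV Suc.prems by blast
    have "d w v \<le> d w p + 1" using d_adj[of v p w] p w adj_sym by auto
    moreover have "d u v \<le> d u w + d w v" using d_tri w Suc.prems by auto
    ultimately have "d u v = k + d w v" using w p l by linarith
    then show ?case using w by blast
  qed
  then show ?thesis using that by blast
qed

lemma d_le_3: "u \<approx> a \<Longrightarrow> a \<approx> b \<Longrightarrow> b \<approx> v \<Longrightarrow> d u v \<le> 3"
  using d_le_2[of u a b] d_adj[of v b u] adj_sym[of b v] adj_inV(1)[of u a] by fastforce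

end

context hh_free
begin

text \<open>An upper bound \<open>z\<close> would produce an induced cycle of length eight through \<open>s\<close>, \<open>u\<close> and \<open>v\<close>.\<close>

lemma no_common_upper_bound:
  assumes V: "s \<in> V" "z \<in> V" "u \<in> V" "v \<in> V"
    and l: "d s u = 2" "d s v = 2" "d u v = 4" "d s z = 2 + d u z" "d s z = 2 + d v z"
  shows False
proof -
  define k where "k = d z u"
  have k: "d z u = k" "d z v = k" "d z s = k + 2"
    using k_def l V d_sym by auto
  obtain x where x: "x \<approx> u" "d s x = 1" using d_pred[of s u 1] V l by auto
  obtain y where y: "y \<approx> v" "d s y = 1" using d_pred[of s v 1] V l by auto
  have xyV: "x \<in> V" "y \<in> V" using x y adj_inV by auto
  have sx: "s \<approx> x" "s \<approx> y" using x y d_eq_1 V xyV by auto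
  have kx: "d z x = Suc k"
    using d_adj[of s x z] d_adj[of x u z] sx x k V by auto
  have ky: "d z y = Suc k"
    using d_adj[of s y z] d_adj[of y v z] sx y k V by auto
  have far2: "\<not> (u \<approx> a \<and> a \<approx> v)" for a using d_le_2[of u a v] l by auto
  have far3: "\<not> (u \<approx> a \<and> a \<approx> b \<and> b \<approx> v)" for a b using d_le_3[of u a b v] l by auto
  have s: "u \<approx> x" "x \<approx> s" "v \<approx> y" "y \<approx> s" using x y sx adj_sym by auto
  have xy: "x \<noteq> y" using far2[of x] s y by auto
  \<comment> \<open>Quadrangles seen from \<open>z\<close> build a second connection of
    \<open>u\<close> and \<open>v\<close>: first \<open>w\<close>, then \<open>t\<close> and
    \<open>t'\<close>, then \<open>q\<close>, at distances \<open>k\<close>, \<open>k - 1\<close>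
    and \<open>k - 2\<close> from \<open>z\<close>.\<close>
  obtain w where w: "w \<approx> x" "w \<approx> y" "Suc (d z w) = Suc k"
    using quadrangle[OF V(2) sx xy kx ky] k by auto
  have uw: "u \<noteq> w" "v \<noteq> w"
    using far2[of y] far2[of x] w y s adj_sym by auto
  obtain t where t: "t \<approx> u" "t \<approx> w" "Suc (d z t) = k"
    using quadrangle[OF V(2) x(1) _ uw(1) k(1)] w kx adj_sym by auto
  obtain t' where t': "t' \<approx> v" "t' \<approx> w" "Suc (d z t') = k"
    using quadrangle[OF V(2) y(1) _ uw(2) k(2)] w ky adj_sym by auto
  have tt: "t \<noteq> t'" using far2[of t] t t' adj_sym by auto
  obtain q where q: "q \<approx> t" "q \<approx> t'" "Suc (d z q) = d z t"
    using quadrangle[OF V(2), of w t t' "d z t"] t t' tt w adj_sym by auto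
  \<comment> \<open>The cycle in question is \<open>s x u t q t' v y\<close>. Distances from
    \<open>z\<close> leave only \<open>u\<close> and \<open>v\<close> as common neighbours of
    \<open>x\<close> and \<open>y\<close>, and either would bring \<open>u\<close> and
    \<open>v\<close> within distance two.\<close>
  let ?Y = "{u, t, q, t', v}"
  have "conn ?Y"
    using conn_insert[OF conn_insert[OF conn_insert[OF conn_insert[OF conn_single[of v], of v t'], of t' q], of q t], of t u]
      t t' q adj_sym by auto
  moreover have "?Y \<subseteq> V" using V t t' q adj_inV by auto
  moreover have "\<not> s \<approx> e" if "e \<in> ?Y" for e
    using that d_adj[of s e z] k t t' q V by auto
  ultimately have "\<exists>e\<in>?Y. x \<approx> e \<and> y \<approx> e"
    using sx xy x y by (intro common_neighbour[of ?Y s x y u v]) auto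
  then obtain e where e: "e \<in> ?Y" "x \<approx> e" "y \<approx> e" by blast
  then have "d z e \<ge> k" using d_adj[of x e z] kx V by auto
  then have "e = u \<or> e = v" using e t t' q by auto
  then show False using far2[of y] far2[of x] e s y x adj_sym by auto
qed

text \<open>Otherwise all vertices of a geodesic \<open>s x0 u0 c\<close> have distance
  \<open>D\<close> from \<open>r\<close>. The triangle condition gives vertices \<open>y\<close>,
  \<open>e\<close>, \<open>h\<close> at distance \<open>D - 1\<close> on its three edges; excluding
  houses makes \<open>y e h\<close> a path, and the same argument one level lower leads to a
  contradiction.\<close>

lemma closer_level1:
  assumes V: "r \<in> V" "s \<in> V" "c \<in> V" and D: "d r s = D" "\<And>v. v \<in> V \<Longrightarrow> d r v \<le> D"
    and c: "d s c = 3"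
  shows "\<exists>x u. s \<approx> x \<and> x \<approx> u \<and> u \<approx> c \<and> Suc (d r x) = D"
proof (rule ccontr)
  assume no: "\<not> ?thesis"
  have fx: "d r x = D" if "s \<approx> x" "x \<approx> u" "u \<approx> c" for x u
  proof -
    have "D \<le> d r x + 1" using d_adj[of s x r] that V D by auto
    moreover have "d r x \<le> D" using D that adj_inV by blast
    moreover have "Suc (d r x) \<noteq> D" using no that by blast
    ultimately show ?thesis by linarith
  qed
  have lev: "\<not> s \<approx> c" "\<And>x. s \<approx> x \<Longrightarrow> \<not> x \<approx> c" "s \<noteq> c"
    "\<And>x u. u \<approx> c \<Longrightarrow> x \<approx> u \<Longrightarrow> s \<noteq> x \<Longrightarrow> \<not> s \<approx> u"
    using c adj_d1[of s c] d_le_2[of s _ c] by auto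
  obtain u0 where u0: "u0 \<approx> c" "d s u0 = 2" using d_pred[of s c 2] V c by auto
  then obtain x0 where x0: "x0 \<approx> u0" "d s x0 = 1" using d_pred[of s u0 1] V adj_inV by auto
  then have sx0: "s \<approx> x0" using d_eq_1 V adj_inV by metis
  have fu: "d r u = D" if su: "u \<approx> c" "x \<approx> u" "s \<approx> x" for u x
  proof (rule ccontr)
    assume ne: "d r u \<noteq> D"
    have x: "d r x = D" using fx su by blast
    obtain y where y: "y \<approx> s" "y \<approx> x" "Suc (d r y) = D" using triangle[OF V(1) su(3) D(1) x] by blast
    have "d r u \<le> D" using D su adj_inV by blast
    then have u: "Suc (d r u) = D" using ne d_adj[of x u r] x su V by auto
    have "\<not> y \<approx> u" using no y su adj_sym by blast
    moreover have "y \<noteq> u" using lev su y adj_sym by blast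
    moreover obtain e where e: "e \<approx> y" "e \<approx> u" "Suc (d r e) = d r y"
      using quadrangle[OF V(1), of x y u "d r y"] su y x u adj_sym \<open>y \<noteq> u\<close> by auto
    moreover have "\<not> x \<approx> e" using d_adj[of x e r] e y x V by auto
    ultimately have "s \<approx> u \<or> s \<approx> e"
      using house_free[of s x y e u] su y e adj_sym by (auto dest: adj_sym[THEN iffD1])
    moreover have "\<not> s \<approx> u" using lev su by blast
    moreover have "\<not> s \<approx> e" using d_adj[of s e r] e y D V by auto
    ultimately show False by blast
  qed
  obtain y where y: "y \<approx> s" "y \<approx> x0" "Suc (d r y) = D"
    using triangle[OF V(1) sx0 D(1)] fx sx0 x0 u0 by metis
  have f0: "d r x0 = D" "d r u0 = D" using fx fu sx0 x0 u0 by blast+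
  obtain e where e: "e \<approx> x0" "e \<approx> u0" "Suc (d r e) = D"
    using triangle[OF V(1) x0(1) f0] by blast
  have ec: "\<not> e \<approx> c" using fu[of e x0] e sx0 adj_sym by auto
  have es: "\<not> e \<approx> s" using no e u0 adj_sym by blast
  have yu: "\<not> y \<approx> u0" using no y u0 adj_sym by blast
  \<comment> \<open>Otherwise \<open>x0 y e' e\<close> is the base of a house with roof
    \<open>s\<close>.\<close>
  have ye: "y \<approx> e"
  proof (rule ccontr)
    assume n: "\<not> y \<approx> e"
    have "y \<noteq> e" using es y by auto
    then obtain e' where e': "e' \<approx> y" "e' \<approx> e" "Suc (d r e') = d r y"
      using quadrangle[OF V(1), of x0 y e "d r y"] y e f0 adj_sym by auto
    have "\<not> x0 \<approx> e'" using d_adj[of x0 e' r] e' y f0 V by auto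
    then have "s \<approx> e \<or> s \<approx> e'"
      using house_free[of s x0 y e' e] sx0 y e e' n by (auto dest: adj_sym[THEN iffD1])
    moreover have "\<not> s \<approx> e'" using d_adj[of s e' r] e' y D V by auto
    ultimately show False using es adj_sym by blast
  qed
  have x0c: "\<not> x0 \<approx> c" using lev sx0 by blast
  have fc: "d r c = D"
  proof (rule ccontr)
    assume "d r c \<noteq> D"
    then have c': "Suc (d r c) = D" using D(2)[OF V(3)] d_adj[of u0 c r] u0 f0 V by auto
    have "e \<noteq> c" using x0c e adj_sym by auto
    then obtain g where g: "g \<approx> e" "g \<approx> c" "Suc (d r g) = d r c"
      using quadrangle[OF V(1), of u0 e c "d r c"] e u0 f0 c' adj_sym by auto
    have "\<not> u0 \<approx> g" using d_adj[of u0 g r] g c' f0 V by auto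
    then have "x0 \<approx> c \<or> x0 \<approx> g"
      using house_free[of x0 u0 e g c] x0 e u0 g ec by (auto dest: adj_sym[THEN iffD1])
    moreover have "\<not> x0 \<approx> g" using d_adj[of x0 g r] g c' f0 V by auto
    ultimately show False using x0c by blast
  qed
  obtain h where h: "h \<approx> u0" "h \<approx> c" "Suc (d r h) = D"
    using triangle[OF V(1) u0(1) f0(2) fc] by blast
  have hs: "\<not> x \<approx> h" if "s \<approx> x" for x using fu[of h x] h that by auto
  have "s \<noteq> h" using lev h by auto
  have he: "h \<approx> e"
  proof (rule ccontr)
    assume n: "\<not> h \<approx> e"
    have "h \<noteq> e" using ec h by auto
    then obtain g where g: "g \<approx> h" "g \<approx> e" "Suc (d r g) = d r h"
      using quadrangle[OF V(1), of u0 h e "d r h"] h e f0 adj_sym by auto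
    have "\<not> u0 \<approx> g" using d_adj[of u0 g r] g h f0 V by auto
    then have "x0 \<approx> h \<or> x0 \<approx> g"
      using house_free[of x0 u0 e g h] x0 e g h n by (auto dest: adj_sym[THEN iffD1])
    moreover have "\<not> x0 \<approx> g" using d_adj[of x0 g r] g h f0 V by auto
    ultimately show False using hs sx0 by blast
  qed
  have yh: "\<not> y \<approx> h" using hs y adj_sym by blast
  have yh2: "y \<noteq> h" using hs[OF sx0] y adj_sym by blast
  have two: "\<not> g \<approx> x0" "\<not> g \<approx> u0" if "Suc (Suc (d r g)) = D" for g
    using that d_adj[of x0 g r] d_adj[of u0 g r] f0 V adj_sym by fastforce+
  have yu2: "y \<noteq> u0" using yu x0 y(1) lev u0 adj_sym by blast
  \<comment> \<open>Apply \<open>common_neighbour\<close> with apex \<open>x0\<close>: such a set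
    would contain a common neighbour of \<open>u0\<close> and \<open>y\<close>, but vertices at
    distance \<open>D - 2\<close> from \<open>r\<close> are not adjacent to \<open>u0\<close>, and
    \<open>h\<close> is not adjacent to \<open>y\<close>.\<close>
  have cyc: False if Y: "conn Y" "h \<in> Y" "Y \<subseteq> V" "g \<in> Y" "y \<approx> g" "\<And>a. a \<in> Y \<Longrightarrow> a \<noteq> h \<Longrightarrow> Suc (Suc (d r a)) = D" for Y g
  proof -
    have "\<exists>a\<in>Y. u0 \<approx> a \<and> y \<approx> a"
    proof (rule common_neighbour[OF Y(1,3), of x0 u0 y h g])
      show "\<not> x0 \<approx> a" if "a \<in> Y" for a using two(1)[of a] hs[OF sx0] Y(6)[OF that] adj_sym by blast
    qed (use x0 y yu2 h Y adj_sym in auto)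
    then obtain a where "a \<in> Y" "u0 \<approx> a" "y \<approx> a" by blast
    then show False using two(2)[of a] Y(6)[of a] yh adj_sym by blast
  qed
  obtain g1 where g1: "g1 \<approx> y" "g1 \<approx> e" "Suc (d r g1) = d r y"
    using triangle[OF V(1) ye, of "d r y"] y e by auto
  obtain g2 where g2: "g2 \<approx> h" "g2 \<approx> e" "Suc (d r g2) = d r h"
    using triangle[OF V(1) he, of "d r h"] h e by auto
  have D12: "Suc (Suc (d r g1)) = D" "Suc (Suc (d r g2)) = D" using g1 g2 y h by auto
  have gV: "g1 \<in> V" "g2 \<in> V" "h \<in> V" using g1 g2 h adj_inV by auto
  have n1: "\<not> g1 \<approx> h"
    using cyc[of "{g1, h}" g1] conn_insert[OF conn_single[of h], of h g1] D12 g1 gV adj_sym by auto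
  have n2: "\<not> y \<approx> g2"
    using cyc[of "{g2, h}" g2] conn_insert[OF conn_single[of h], of h g2] D12 g2 gV adj_sym by auto
  have n12: "\<not> g1 \<approx> g2"
  proof
    assume "g1 \<approx> g2"
    then have "conn {g1, g2, h}"
      using conn_insert[OF conn_insert[OF conn_single[of h], of h g2], of g2 g1] g2 by auto
    then show False
      by (rule cyc[of _ g1]) (use D12 g1 gV adj_sym in auto)
  qed
  \<comment> \<open>The quadrangle \<open>e g1 g0 g2\<close> is now the base of a house with roof
    \<open>y\<close>.\<close>
  have "g1 \<noteq> g2" using n1 g2 by auto
  then obtain g0 where g0: "g0 \<approx> g1" "g0 \<approx> g2" "Suc (d r g0) = d r g1"
    using quadrangle[OF V(1), of e g1 g2 "d r g1"] g1 g2 D12 y e adj_sym by auto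
  have "\<not> e \<approx> g0" using d_adj[of e g0 r] g0 D12 e V by auto
  then have "y \<approx> g2 \<or> y \<approx> g0"
    using house_free[of y e g1 g0 g2] ye g1 g2 g0 n12 adj_sym by (auto dest: adj_sym[THEN iffD1])
  moreover have "\<not> y \<approx> g0" using d_adj[of y g0 r] g0 D12 y V by auto
  ultimately show False using n2 by blast
qed

text \<open>The vertex \<open>g\<close> is what \<open>push\<close> in
  \<open>no_opposite_far\<close> needs to bring \<open>u\<close> down to distance
  \<open>D - 2\<close> from \<open>r\<close>. To obtain it, the middle vertex found by
  \<open>closer_level1\<close> may have to be replaced.\<close>

lemma closer_level2:
  assumes V: "r \<in> V" "s \<in> V" "c \<in> V" and D: "d r s = D" "\<And>v. v \<in> V \<Longrightarrow> d r v \<le> D"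
    and c: "d s c = 3"
  obtains x u g where "s \<approx> x" "x \<approx> u" "u \<approx> c" "Suc (d r x) = D" "g \<approx> x" "Suc (Suc (d r g)) = D" "u = g \<or> u \<approx> g"
proof -
  note res = that
  obtain x u where x: "s \<approx> x" "x \<approx> u" "u \<approx> c" "Suc (d r x) = D"
    using closer_level1[OF V D c] by blast
  have xc: "\<not> x \<approx> c" "x \<noteq> c" using c d_le_2[of s x c] adj_d1[of s c] x by auto
  \<comment> \<open>A middle vertex closer than \<open>D\<close> suffices: either it is
    \<open>g\<close> itself, or the triangle condition on the edge from \<open>x\<close> to it
    supplies \<open>g\<close>.\<close>
  have key: ?thesis if u': "x \<approx> u'" "u' \<approx> c" "d r u' \<noteq> D" for u'
  proof -
    have uD: "d r u' \<le> D" using D u' adj_inV by blast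
    have "D \<le> d r u' + 2" using d_adj[of x u' r] u' x V by auto
    then consider "Suc (Suc (d r u')) = D" | "Suc (d r u') = D" using u'(3) uD by linarith
    then show ?thesis
    proof cases
      case 1 then show ?thesis using res[of x u' u'] x u' adj_sym by blast
    next
      case 2
      then obtain g where "g \<approx> x" "g \<approx> u'" "Suc (d r g) = d r x"
        using triangle[OF V(1) u'(1), of "d r x"] x by auto
      then show ?thesis using res[of x u' g] x u' adj_sym by auto
    qed
  qed
  show ?thesis
  proof (cases "d r u = D")
    case False then show ?thesis using key x by blast
  next
    case True
    show ?thesis
    proof (cases "d r c = D")
      case False
      then have cD: "Suc (d r c) = D" using D(2)[OF V(3)] d_adj[of u c r] x True V by auto
      then obtain g where g: "g \<approx> x" "g \<approx> c" "Suc (d r g) = d r x"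
        using quadrangle[OF V(1), of u x c "d r x"] x True xc adj_sym by auto
      then show ?thesis using res[of x g g] x adj_sym by auto
    next
      case cD: True
      obtain h where h: "h \<approx> u" "h \<approx> c" "Suc (d r h) = D"
        using triangle[OF V(1) x(3) True cD] by blast
      show ?thesis
      proof (cases "x \<approx> h")
        case True then show ?thesis using key h by auto
      next
        case False
        have "x \<noteq> h" using xc h by auto
        then obtain g where g: "g \<approx> x" "g \<approx> h" "Suc (d r g) = d r x"
          using quadrangle[OF V(1), of u x h "d r x"] x h True adj_sym by auto
        have "\<not> u \<approx> g" using d_adj[of u g r] g x True V by auto
        then have "c \<approx> x \<or> c \<approx> g"
          using house_free[of c u h g x] h g x False by (auto dest: adj_sym[THEN iffD1])
        moreover have "\<not> c \<approx> g" using d_adj[of c g r] g x cD V by auto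
        ultimately show ?thesis using xc adj_sym by blast
      qed
    qed
  qed
qed

text \<open>The vertices \<open>u\<close> and \<open>v\<close>, two steps from \<open>s\<close>
  towards \<open>c\<close> and \<open>c'\<close>, both turn out to have distance
  \<open>D - 2\<close> from \<open>r\<close>. Thus \<open>r\<close> lies beyond both as seen from
  \<open>s\<close>, contrary to \<open>no_common_upper_bound\<close>.\<close>

lemma no_opposite_far:
  assumes V: "r \<in> V" "s \<in> V" "c \<in> V" "c' \<in> V" and D: "d r s = D" "\<And>v. v \<in> V \<Longrightarrow> d r v \<le> D"
    and c: "d s c \<ge> 3" "d s c' \<ge> 3" "d c c' = d s c + d s c'"
  shows False
proof -
  obtain e where e: "e \<in> V" "d s e = 3" "d s c = 3 + d e c" using geodesic_point V c by metis
  obtain e' where e': "e' \<in> V" "d s e' = 3" "d s c' = 3 + d e' c'" using geodesic_point V c by metis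
  have ee: "d e e' \<ge> 6"
    using d_tri[of c e c'] d_tri[of e e' c'] d_sym[of c e] V e e' c by linarith
  obtain x u g where x: "s \<approx> x" "x \<approx> u" "u \<approx> e" "Suc (d r x) = D" "g \<approx> x" "Suc (Suc (d r g)) = D" "u = g \<or> u \<approx> g"
    using closer_level2[OF V(1,2) e(1) D e(2)] by blast
  obtain y v h where y: "s \<approx> y" "y \<approx> v" "v \<approx> e'" "Suc (d r y) = D" "h \<approx> y" "Suc (Suc (d r h)) = D" "v = h \<or> v \<approx> h"
    using closer_level2[OF V(1,2) e'(1) D e'(2)] by blast
  have uvV: "u \<in> V" "v \<in> V" "x \<in> V" "y \<in> V" using x y adj_inV by auto
  have "d e e' \<le> 2 + d u v"
    using d_tri[of e u e'] d_tri[of u v e'] adj_d1[of u e] adj_d1[of v e'] x y uvV e e' d_sym[of e u] by auto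
  moreover have "d u v \<le> d u s + d s v" using d_tri uvV V by auto
  moreover have "d u s \<le> 2" "d s v \<le> 2" using d_le_2[of s x u] d_le_2[of s y v] x y d_sym[of u s] uvV V by auto
  ultimately have uv: "d u v = 4" "d s u = 2" "d s v = 2" using ee d_sym[of u s] uvV V by auto
  have far2: "\<not> (u \<approx> a \<and> a \<approx> v)" for a using d_le_2[of u a v] uv by auto
  have far3: "\<not> (u \<approx> a \<and> a \<approx> b \<and> b \<approx> v)" for a b using d_le_3[of u a b v] uv by auto
  have xy: "x \<noteq> y" "\<not> x \<approx> y" using far2[of x] far3[of x y] x y adj_sym by auto
  obtain w where w: "w \<approx> x" "w \<approx> y" "Suc (d r w) = d r x"
    using quadrangle[OF V(1), of s x y "d r x"] x y xy D adj_sym by auto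
  have sw: "\<not> s \<approx> w" using d_adj[of s w r] w x D V by auto
  \<comment> \<open>Stated for both sides at once. Excluding a house with base
    \<open>x' g' t w\<close> and roof \<open>a\<close> gives \<open>a\<close> a neighbour
    \<open>t\<close> at distance \<open>D - 3\<close> from \<open>r\<close>.\<close>
  have push: "d r a = d r w"
    if a: "x' \<approx> a" "\<not> a \<approx> w" "a \<noteq> w" "Suc (d r x') = D" "g' \<approx> x'" "Suc (Suc (d r g')) = D" "a = g' \<or> a \<approx> g'"
      and x': "s \<approx> x'" "s \<approx> y'" "w \<approx> x'" "w \<approx> y'" "x' \<noteq> y'" "\<not> x' \<approx> y'" and g'y: "\<not> (a \<approx> g' \<and> g' \<approx> y')" "\<not> a \<approx> y'"
    for a x' y' g'
  proof (cases "a = g'")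
    case True then show ?thesis using a w x by auto
  next
    case False
    then have ag: "a \<approx> g'" using a by blast
    have gs: "\<not> g' \<approx> s" using d_adj[of s g' r] a D V adj_sym by auto
    have gw: "g' \<noteq> w" using a ag by auto
    have "\<not> g' \<approx> w"
    proof
      assume "g' \<approx> w"
      then have "g' \<approx> y' \<or> g' \<approx> s"
        using house_free[of g' x' w y' s] a x' sw by (auto dest: adj_sym[THEN iffD1])
      then show False using gs ag g'y by blast
    qed
    obtain t where t: "t \<approx> g'" "t \<approx> w" "Suc (d r t) = d r w"
      using quadrangle[OF V(1), of x' g' w "d r w"] a w x gw x' adj_sym by auto
    have "\<not> x' \<approx> t" using d_adj[of x' t r] t w x a V by auto
    then have "a \<approx> t \<or> a \<approx> w"
      using house_free[of a x' g' t w] a ag x' t \<open>\<not> g' \<approx> w\<close> by (auto dest: adj_sym[THEN iffD1])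
    then have "a \<approx> t" using a by blast
    then have "d r a \<le> d r w" using d_adj[of a t r] t V by auto
    moreover have "d r x' \<le> d r a + 1" using d_adj[of x' a r] a V by auto
    ultimately show ?thesis using a w x by auto
  qed
  have uw: "\<not> u \<approx> w" "\<not> v \<approx> w" "u \<noteq> w" "v \<noteq> w"
    using far3[of w y] far3[of x w] far2[of y] far2[of x] w x y adj_sym by auto
  have ru: "d r u = d r w"
    by (rule push[of x u g y]) (use x y w xy uw far3[of g y] far2[of y] adj_sym in auto)
  have rv: "d r v = d r w"
  proof (rule push[of y v h x])
    show "\<not> (v \<approx> h \<and> h \<approx> x)" using far3[of x h] x adj_sym by blast
    show "\<not> v \<approx> x" using far2[of x] x adj_sym by blast
  qed (use x y w xy uw adj_sym in auto)
  show False
    by (rule no_common_upper_bound[of s r u v])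
      (use V uvV uv ru rv w x D d_sym[of s r] d_sym[of u r] d_sym[of v r] in auto)
qed

text \<open>The set \<open>X\<close> of vertices beyond \<open>c\<close> as seen from
  \<open>s\<close> is attached to the rest only at \<open>c\<close>. So \<open>c\<close> is between
  \<open>c'\<close> and every vertex outside \<open>X\<close>, while the vertices of
  \<open>X\<close> are comparable with \<open>c'\<close> because the two lines agree.\<close>

lemma nested_universal:
  assumes V: "s \<in> V" "c \<in> V" "c' \<in> V" "c \<noteq> c'" and c: "d s c \<ge> 2" "d s c' = d s c + d c c'"
    and eq: "ln s c = ln s c'"
  shows "ln c c' = V"
proof -
  have cc: "d c c' \<ge> 1" using d_eq_0[of c c'] V by (simp add: Suc_le_eq)
  \<comment> \<open>Otherwise \<open>s\<close> is between \<open>z\<close> and \<open>c\<close>. The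
    first steps \<open>x\<close> towards \<open>c\<close> and \<open>y\<close> towards
    \<open>z\<close> have a common neighbour \<open>w\<close> two steps from \<open>s\<close> on the
    way to \<open>c'\<close>. It lies on \<open>sc\<close>, but no position is possible, as
    \<open>x\<close> is closer to \<open>c\<close> than \<open>s\<close> and \<open>y\<close> is
    farther.\<close>
  have le_comparable: "d s z = d s c + d c z \<or> d s c = d s z + d z c"
    if z: "z \<in> V" "d s c' = d s z + d z c'" for z
  proof (rule ccontr)
    assume nc: "\<not> ?thesis"
    have "z \<in> ln s c'" using z by (simp add: mem_line)
    then have "z \<in> ln s c" using eq by simp
    then have opp: "d z c = d z s + d s c" using nc d_sym z V by (auto simp: mem_line)
    have "d s z \<noteq> 0" using nc d_eq_0 z V by auto
    then obtain y where y: "y \<in> V" "d s y = 1" "d s z = 1 + d y z" using geodesic_point[of s z 1] z V by auto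
    obtain x where x: "x \<in> V" "d s x = 1" "d s c = 1 + d x c" using geodesic_point[of s c 1] c V by auto
    have sxy: "s \<approx> x" "s \<approx> y" using x y V d_eq_1 by auto
    have yc: "d y c = 1 + d s c"
      using d_tri[of z y c] d_tri[of y s c] d_sym[of z y] d_sym[of y s] d_sym[of z s] opp y z V by linarith
    have xy: "x \<noteq> y" using x yc by auto
    have x': "Suc (d c' x) = d c' s" 
      using d_tri[of x c c'] d_tri[of s x c'] d_sym[of c' x] d_sym[of c' s] x c V by linarith
    have y': "Suc (d c' y) = d c' s"
      using d_tri[of y z c'] d_tri[of s y c'] d_sym[of c' y] d_sym[of c' s] y z V by linarith
    obtain w where w: "w \<approx> x" "w \<approx> y" "Suc (d c' w) = d c' x"
      using quadrangle[OF V(3) sxy xy, of "d c' x"] x' y' by auto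
    have wV: "w \<in> V" using w adj_inV by auto
    have sw: "d s w = 2"
      using d_le_2[of s x w] sxy w adj_sym[of w x] d_tri[of s w c'] d_sym[of c' w] d_sym[of c' s] x' wV V by auto
    have "d s c' = d s w + d w c'" using sw w x' d_sym[of c' w] d_sym[of c' s] wV V by auto
    then have "w \<in> ln s c" using eq wV by (simp add: mem_line)
    then consider "d s c = 2 + d w c" | "d w c = 2 + d s c" | "2 = d s c + d c w"
      using sw d_sym[of w s] wV V by (auto simp: mem_line)
    then show False
    proof cases
      case 1 then show False using d_adj'[of y w c] w yc V adj_sym[of w y] by auto
    next
      case 2 then show False using d_adj'[of w x c] w x V by auto
    next
      case 3
      then have "d c w = 0" using c by simp
      then show False using d_eq_0[of c w] d_adj'[of y w c] w yc V wV c adj_sym[of w y] by auto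
    qed
  qed
  have ge_comparable: "d s c' = d s z + d z c' \<or> d s z = d s c' + d c' z"
    if z: "z \<in> V" "d s z = d s c + d c z" for z
  proof -
    have "z \<in> ln s c" using z by (simp add: mem_line)
    then have "z \<in> ln s c'" using eq by simp
    moreover have "d z c' \<noteq> d z s + d s c'"
      using d_tri[of z c c'] d_sym[of z c] d_sym[of z s] z c V cc by auto
    ultimately show ?thesis by (auto simp: mem_line)
  qed
  define X where "X = {z \<in> V. d s z = d s c + d c z}"
  have up: "b \<in> X" if "a \<in> X" "b \<approx> a" "d s b = Suc (d s a)" for a b
  proof -
    have "b \<in> V" "a \<in> V" using that adj_inV by auto
    then show ?thesis
      using that d_adj[of b a c] d_tri[of s c b] V unfolding X_def by auto
  qed
  \<comment> \<open>If \<open>a\<close> lies beyond \<open>c'\<close>, the quadrangle condition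
    links \<open>q\<close> to a predecessor \<open>p\<close> of \<open>a\<close> towards
    \<open>c'\<close>; the induction hypothesis for \<open>p\<close> and then \<open>up\<close>
    apply.\<close>
  have down: "q \<in> X" if "a \<in> X" "a \<noteq> c" "q \<approx> a" "Suc (d s q) = d s a" for a q
    using that
  proof (induction "d s a" arbitrary: a q rule: less_induct)
    case less
    have aV: "a \<in> V" "q \<in> V" using less.prems adj_inV by auto
    have a: "d s a = d s c + d c a" using less.prems X_def by auto
    have ca: "d c a \<noteq> 0" using d_eq_0 V aV less.prems by auto
    consider "d s c' = d s a + d a c'" | "d s a = d s c' + d c' a" "a \<noteq> c'"
      using ge_comparable[OF aV(1) a] by fastforce
    then show ?case
    proof cases
      case 1
      have "d s c' = d s q + d q c'"
        using 1 less.prems d_adj'[of q a c'] d_tri[of s q c'] aV V by auto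
      then consider "d s q = d s c + d c q" | "d s c = d s q + d q c" using le_comparable aV by blast
      then show ?thesis
      proof cases
        case 1 then show ?thesis using X_def aV by auto
      next
        case 2
        then have "d q c = 0" using a ca less.prems by linarith
        then show ?thesis using d_eq_0[of q c] aV V X_def by auto
      qed
    next
      case 2
      have "d c' a \<noteq> 0" using d_eq_0[of c' a] 2 V aV by auto
      then obtain k where k: "d c' a = Suc k" using not0_implies_Suc by blast
      then obtain p where p: "p \<approx> a" "d c' p = k" using d_pred V aV by metis
      have pV: "p \<in> V" using p adj_inV by auto
      have sp: "d s p = d s c' + d c' p" "Suc (d s p) = d s a"
        using 2 p k d_tri[of s c' p] d_adj[of a p s] adj_sym[of a p] V pV by auto
      have pX: "p \<in> X"
        using sp c d_tri[of c c' p] d_tri[of s c p] pV V unfolding X_def by auto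
      have pc: "p \<noteq> c" using sp c cc by auto
      show ?thesis
      proof (cases "p = q")
        case True then show ?thesis using pX by simp
      next
        case False
        obtain e where e: "e \<approx> p" "e \<approx> q" "Suc (d s e) = d s p"
          using quadrangle[OF V(1), of a p q "d s p"] p less.prems False sp adj_sym by auto
        have "e \<in> X" using less.hyps[of p e] pX pc e sp by auto
        then show ?thesis using up[of e q] e less.prems sp adj_sym by auto
      qed
    qed
  qed
  \<comment> \<open>For neighbours at equal distance from \<open>s\<close>, the triangle condition
    gives a common predecessor, to which \<open>down\<close> and then \<open>up\<close>
    apply.\<close>
  have cut: "a = c" if ab: "a \<in> X" "b \<notin> X" "b \<approx> a" for a b
  proof (rule ccontr)
    assume ac: "a \<noteq> c"
    have abV: "a \<in> V" "b \<in> V" using ab adj_inV by auto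
    have "d s b \<le> d s a + 1" "d s a \<le> d s b + 1"
      using d_adj[of a b s] d_adj[of b a s] ab V adj_sym by auto
    then consider "d s b = Suc (d s a)" | "d s b = d s a" | "Suc (d s b) = d s a" by linarith
    then show False
    proof cases
      case 1 then show False using up ab by blast
    next
      case 3 then show False using down ab ac by blast
    next
      case 2
      then obtain e where e: "e \<approx> b" "e \<approx> a" "Suc (d s e) = d s a"
        using triangle[OF V(1) ab(3)] by metis
      then have "e \<in> X" using down ab ac by blast
      then show False using up[of e b] e ab 2 adj_sym by auto
    qed
  qed
  have c'X: "c' \<in> X" using c V X_def by auto
  \<comment> \<open>A shortest path from \<open>z\<close> to \<open>c'\<close> can enter
    \<open>X\<close> only at \<open>c\<close>.\<close>
  have out: "d z c' = d z c + d c c'" if "z \<in> V" "z \<notin> X" for z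
    using that
  proof (induction "d z c'" arbitrary: z)
    case 0 then show ?case using d_eq_0[of z c'] V c'X by auto
  next
    case (Suc m)
    obtain w where w: "w \<approx> z" "d c' w = m" using d_pred[of c' z m] Suc V d_sym[of z c'] by auto
    have wV: "w \<in> V" "m = d w c'" using w adj_inV d_sym V by auto
    have "d w c' = d w c + d c c'"
    proof (cases "w \<in> X")
      case True then have "w = c" using cut[of w z] w Suc adj_sym by blast
      then show ?thesis by simp
    next
      case False then show ?thesis using Suc.hyps(1) wV by auto
    qed
    moreover have "d z c \<le> d w c + 1" using d_adj'[of z w c] w adj_sym V by auto
    moreover have "d z c' \<le> d z c + d c c'" using d_tri Suc V by auto
    ultimately show ?case using Suc wV by linarith
  qed
  show ?thesis
  proof
    show "ln c c' \<subseteq> V" by (auto simp: mem_line)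
    show "V \<subseteq> ln c c'"
    proof
      fix z assume z: "z \<in> V"
      show "z \<in> ln c c'"
      proof (cases "z \<in> X")
        case False then show ?thesis using out z by (auto simp: mem_line)
      next
        case True
        then have zX: "d s z = d s c + d c z" using X_def by auto
        then show ?thesis using ge_comparable[OF z zX] c z by (auto simp: mem_line)
      qed
    qed
  qed
qed

end


section \<open>Ranks inside a connected set, and its boundary\<close>

lemma (in conn_graph) conn_rank:
  assumes C: "conn C" and T: "T \<subseteq> C" "T \<noteq> {}"
  obtains \<delta> :: "'a \<Rightarrow> nat" where "\<And>z. z \<in> C \<Longrightarrow> \<delta> z = 0 \<longleftrightarrow> z \<in> T"
    "\<And>z. z \<in> C \<Longrightarrow> \<delta> z \<noteq> 0 \<Longrightarrow> \<exists>w\<in>C. z \<approx> w \<and> Suc (\<delta> w) = \<delta> z"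
    "\<And>z w. z \<in> C \<Longrightarrow> w \<in> C \<Longrightarrow> z \<approx> w \<Longrightarrow> \<delta> z \<le> Suc (\<delta> w)"
proof -
  let ?R = "E \<inter> C \<times> C"
  let ?P = "\<lambda>z k. \<exists>t\<in>T. (z, t) \<in> ?R ^^ k"
  \<comment> \<open>Walks are restricted to \<open>C\<close>, so this distance to \<open>T\<close>
    can exceed the one in the whole graph.\<close>
  define \<delta> where "\<delta> z = (LEAST k. ?P z k)" for z
  have ex: "\<exists>k. ?P z k" if "z \<in> C" for z
  proof -
    obtain t where "t \<in> T" using T by blast
    then have "(z, t) \<in> ?R\<^sup>*" using C T that unfolding conn_def by blast
    then show ?thesis using \<open>t \<in> T\<close> unfolding rtrancl_power by blast
  qed
  have \<delta>: "?P z (\<delta> z)" if "z \<in> C" for z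
    unfolding \<delta>_def by (rule LeastI_ex[OF ex[OF that]])
  have le: "\<delta> z \<le> k" if "?P z k" for z k
    unfolding \<delta>_def using that by (rule Least_le)
  have step: "\<delta> z \<le> Suc (\<delta> w)" if zw: "z \<in> C" "w \<in> C" "z \<approx> w" for z w
  proof -
    obtain t where "t \<in> T" "(w, t) \<in> ?R ^^ \<delta> w" using \<delta>[OF zw(2)] by blast
    moreover have "(z, w) \<in> ?R" using zw by blast
    ultimately have "(z, t) \<in> ?R ^^ Suc (\<delta> w)" by (meson relpow_Suc_I2)
    then show ?thesis using le \<open>t \<in> T\<close> by blast
  qed
  have zero: "\<delta> z = 0 \<longleftrightarrow> z \<in> T" if "z \<in> C" for z
  proof
    assume "\<delta> z = 0" then show "z \<in> T" using \<delta>[OF that] by auto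
  next
    assume "z \<in> T" then show "\<delta> z = 0" using le[of z 0] by auto
  qed
  have pred: "\<exists>w\<in>C. z \<approx> w \<and> Suc (\<delta> w) = \<delta> z" if z: "z \<in> C" "\<delta> z \<noteq> 0" for z
  proof -
    obtain k where k: "\<delta> z = Suc k" using z not0_implies_Suc by blast
    obtain t where t: "t \<in> T" "(z, t) \<in> ?R ^^ Suc k" using \<delta>[OF z(1)] k by auto
    then obtain w where w: "(z, w) \<in> ?R" "(w, t) \<in> ?R ^^ k" by (meson relpow_Suc_D2)
    then have "\<delta> w \<le> k" using le t by blast
    moreover have "\<delta> z \<le> Suc (\<delta> w)" using step w z by blast
    ultimately show ?thesis using w k by auto
  qed
  show ?thesis by (rule that[of \<delta>]) (use zero pred step in blast)+
qed

lemma (in conn_graph) geodesic_crosses_boundary: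
  assumes "c \<in> C" "C \<subseteq> V" "v \<in> V" "v \<notin> C"
  shows "\<exists>x\<in>V - C. (\<exists>c'\<in>C. x \<approx> c') \<and> d c v = d c x + d x v"
  using assms(3,4)
proof (induction "d c v" arbitrary: v)
  case 0 then show ?case using d_eq_0[of c v] assms by auto
next
  case (Suc k)
  have cV: "c \<in> V" using assms by blast
  obtain w where w: "w \<approx> v" "d c w = k" using d_pred[of c v k] Suc cV by auto
  show ?case
  proof (cases "w \<in> C")
    case True
    then show ?thesis using Suc.prems w adj_sym[of w v] by (intro bexI[of _ v]) auto
  next
    case False
    then obtain x where x: "x \<in> V - C" "\<exists>c'\<in>C. x \<approx> c'" "d c w = d c x + d x w"
      using Suc.hyps(1)[of w] w adj_inV(1)[of w v] by blast
    have "d x v \<le> d x w + 1" using d_adj[of v w x] w x adj_sym[of w v] by auto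
    moreover have "d c v \<le> d c x + d x v" using d_tri x cV Suc by auto
    ultimately show ?thesis using x w Suc by (intro bexI[of _ x]) auto
  qed
qed

locale hh_no_universal = hh_free +
  assumes no_universal: "\<And>u v. u \<in> V \<Longrightarrow> v \<in> V \<Longrightarrow> u \<noteq> v \<Longrightarrow> ln u v \<noteq> V"
begin

lemma edge_in_triangle: "u \<approx> v \<Longrightarrow> \<exists>p. p \<approx> u \<and> p \<approx> v"
  using triangle_free_edge_universal no_universal adj_inV by (metis adj_irrefl)

end

section \<open>Lines from the extremal vertex\<close>

text \<open>The assumption \<open>A_S\<close> is the form in which the maximality of the component
  \<open>C\<close> enters; \<open>ex_base\<close> provides an instance.\<close>

locale hh_base = hh_no_universal +
  fixes r s :: 'a and C S A :: "'a set"
  assumes CV: "C \<subseteq> V" and connC: "conn C" and rC: "r \<in> C"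
    and S_def: "S = {x \<in> V - C. \<exists>c\<in>C. x \<approx> c}" and A_def: "A = V - C - S"
    and sA: "s \<in> A" and far: "\<And>v. v \<in> V \<Longrightarrow> d r v \<le> d r s"
    and A_S: "\<And>a x. a \<in> A \<Longrightarrow> x \<in> S \<Longrightarrow> a \<approx> x"
begin

lemma SV: "S \<subseteq> V" unfolding S_def by blast

lemma AV: "A \<subseteq> V" unfolding A_def by blast

lemma V_eq: "V = A \<union> S \<union> C" unfolding A_def using SV CV by blast

lemma disj: "A \<inter> S = {}" "A \<inter> C = {}" "S \<inter> C = {}"
  unfolding A_def by (blast, blast, simp add: S_def, blast)

lemma inV [simp]: "x \<in> S \<Longrightarrow> x \<in> V" "a \<in> A \<Longrightarrow> a \<in> V" "c \<in> C \<Longrightarrow> c \<in> V" "s \<in> V" "r \<in> V"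
  using SV AV CV sA rC by blast+

lemma A_C: "a \<in> A \<Longrightarrow> c \<in> C \<Longrightarrow> \<not> a \<approx> c"
  unfolding A_def S_def by blast

lemma s_S: "x \<in> S \<Longrightarrow> s \<approx> x" using A_S sA by blast

lemma ex_C: "x \<in> S \<Longrightarrow> \<exists>c\<in>C. x \<approx> c" unfolding S_def by blast

lemma C_nbr: "c \<in> C \<Longrightarrow> v \<approx> c \<Longrightarrow> v \<in> S \<or> v \<in> C"
  using adj_inV(1)[of v c] unfolding S_def by blast

lemma cross:
  assumes "c \<in> C" "v \<in> V" "v \<notin> C"
  shows "\<exists>x\<in>S. d c v = d c x + d x v"
  using geodesic_crosses_boundary[OF assms(1) CV assms(2,3)] unfolding S_def by blast

text \<open>A geodesic from \<open>c\<close> to \<open>A\<close> passes through \<open>S\<close>,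
  and its final part from \<open>S\<close> can be replaced by an edge to any vertex of
  \<open>A\<close>.\<close>

lemma A_dist:
  assumes "a \<in> A" "b \<in> A" "c \<in> C" shows "d a c = d b c"
proof -
  have le: "d c b \<le> d c a" if ab: "a \<in> A" "b \<in> A" for a b
  proof -
    obtain x where x: "x \<in> S" "d c a = d c x + d x a" using cross[of c a] assms ab disj by auto
    have "d x a = 1" using adj_d1 A_S ab x adj_sym by blast
    moreover have "d c b \<le> d c x + 1" using d_adj[of b x c] A_S ab x assms by auto
    ultimately show ?thesis using x by linarith
  qed
  show ?thesis using le[of a b] le[of b a] assms d_sym by (simp add: le_antisym)
qed

lemma S_nonempty: "S \<noteq> {}" using cross[of r s] rC sA disj by auto

lemma d_s_S: "x \<in> S \<Longrightarrow> d s x = 1" using s_S adj_d1 by blast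

lemma d_s_C: "c \<in> C \<Longrightarrow> d s c \<ge> 2"
proof -
  assume c: "c \<in> C"
  have "d s c \<noteq> 0" using d_eq_0[of s c] c sA disj by auto
  moreover have "d s c \<noteq> 1" using d_eq_1[of s c] c sA A_C by auto
  ultimately show ?thesis by linarith
qed

lemma C_closed: "c \<in> C \<Longrightarrow> v \<approx> c \<Longrightarrow> d s v \<ge> 2 \<Longrightarrow> v \<in> C"
  using C_nbr d_s_S by fastforce

lemma C_nbr_S: "c \<in> C \<Longrightarrow> v \<approx> c \<Longrightarrow> d s v = 1 \<Longrightarrow> v \<in> S"
  using C_nbr d_s_C by fastforce

lemma ex_gate:
  assumes "c \<in> C" obtains y where "y \<in> S" "d s c = 1 + d y c"
proof -
  obtain y where y: "y \<in> S" "d c s = d c y + d y s" using cross[of c s] assms sA disj by auto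
  then show ?thesis using that[of y] d_s_S[of y] d_sym[of y s] d_sym[of c y] d_sym[of c s] assms by auto
qed

text \<open>Apply \<open>common_neighbour\<close> with apex \<open>s\<close>, which has no neighbour
  in \<open>C\<close>.\<close>

lemma S_common:
  assumes "x \<in> S" "y \<in> S" "x \<noteq> y" shows "\<exists>w\<in>C. x \<approx> w \<and> y \<approx> w"
proof -
  obtain c c' where "c \<in> C" "x \<approx> c" "c' \<in> C" "y \<approx> c'" using ex_C assms by blast
  then show ?thesis
    using common_neighbour[OF connC CV, of s x y c c'] s_S assms A_C sA by blast
qed

text \<open>The rank \<open>\<delta>\<close> measures the distance inside \<open>C\<close> to the neighbours of \<open>y\<close>. By \<open>common_neighbour\<close>, adjacency
  to \<open>x\<close> propagates along a descending path until it reaches a neighbour of \<open>y\<close>, which is impossible.\<close>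

lemma fan:
  assumes xy: "x \<in> S" "y \<in> S" "\<not> x \<approx> y"
    and \<delta>0: "\<And>z. z \<in> C \<Longrightarrow> \<delta> z = (0::nat) \<longleftrightarrow> z \<approx> y"
    and \<delta>1: "\<And>z. z \<in> C \<Longrightarrow> \<delta> z \<noteq> 0 \<Longrightarrow> \<exists>w\<in>C. z \<approx> w \<and> Suc (\<delta> w) = \<delta> z"
    and \<delta>2: "\<And>z w. z \<in> C \<Longrightarrow> w \<in> C \<Longrightarrow> z \<approx> w \<Longrightarrow> \<delta> z \<le> Suc (\<delta> w)"
    and b: "b \<in> C" "b' \<in> C" "b \<approx> b'" "Suc (\<delta> b') = \<delta> b" "x \<approx> b" "x \<approx> b'"
  shows False
  using b
proof (induction "\<delta> b'" arbitrary: b b' rule: less_induct)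
  case less
  let ?Z = "{z \<in> C. \<delta> z < \<delta> b'}" 
  \<comment> \<open>The vertex \<open>s\<close> is included to give \<open>x\<close> a neighbour in
    this set; the vertices of smaller rank and \<open>y\<close> serve \<open>b'\<close>.\<close>
  let ?Y = "?Z \<union> {y, s}"
  have hub: "(z, y) \<in> (E \<inter> ?Y \<times> ?Y)\<^sup>*" if "z \<in> ?Z" for z
    using that
  proof (induction "\<delta> z" arbitrary: z)
    case 0
    have "z \<in> C" "\<delta> z = 0" using 0 by auto
    then have "z \<approx> y" using \<delta>0 by blast
    then have "(z, y) \<in> E \<inter> ?Y \<times> ?Y" using 0(2) by blast
    then show ?case by blast
  next
    case (Suc k)
    then obtain w where w: "w \<in> C" "z \<approx> w" "Suc (\<delta> w) = \<delta> z" using \<delta>1 by fastforce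
    then have "(w, y) \<in> (E \<inter> ?Y \<times> ?Y)\<^sup>*" using Suc by auto
    moreover have "(z, w) \<in> E \<inter> ?Y \<times> ?Y" using w Suc by auto
    ultimately show ?case by (rule converse_rtrancl_into_rtrancl[rotated])
  qed
  have "conn ?Y"
  proof (rule conn_hubI[of y])
    fix z assume "z \<in> ?Y"
    then consider "z \<in> ?Z" | "z = y" | "z = s" by blast
    then show "(z, y) \<in> (E \<inter> ?Y \<times> ?Y)\<^sup>*"
    proof cases
      case 3
      then have "(z, y) \<in> E \<inter> ?Y \<times> ?Y" using s_S xy by auto
      then show ?thesis by blast
    qed (use hub in auto)
  qed simp
  moreover have "?Y \<subseteq> V" using xy by auto
  moreover have "\<not> b \<approx> z" if "z \<in> ?Y" for z
    using that \<delta>2[of b z] \<delta>0[of b] less.prems A_C[OF sA, of b] adj_sym[of b s] by auto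
  moreover obtain w where "w \<in> ?Y" "b' \<approx> w"
  proof (cases "\<delta> b' = 0")
    case True then show ?thesis using that[of y] \<delta>0 less.prems by auto
  next
    case False
    then obtain w where "w \<in> C" "b' \<approx> w" "Suc (\<delta> w) = \<delta> b'" using \<delta>1[of b'] less.prems by blast
    then show ?thesis using that[of w] by auto
  qed
  ultimately have "\<exists>e\<in>?Y. x \<approx> e \<and> b' \<approx> e"
    using less.prems xy s_S[OF xy(1)] adj_sym[of x s] adj_sym[of b x] disj
    by (intro common_neighbour[of ?Y b x b' s w]) auto
  then obtain e where e: "e \<in> ?Y" "x \<approx> e" "b' \<approx> e" by blast
  \<comment> \<open>What remains is a vertex of \<open>C\<close> with rank one below
    \<open>b'\<close> and adjacent to \<open>x\<close>, so the induction continues.\<close>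
  have "e \<noteq> s" using e A_C[OF sA, of b'] less.prems adj_sym by blast
  moreover have "e \<noteq> y" using e xy by blast
  ultimately have eC: "e \<in> C" "\<delta> e < \<delta> b'" using e by auto
  then have "Suc (\<delta> e) = \<delta> b'" using \<delta>2[of b' e] e less.prems by auto
  then show False using less.hyps[OF eC(2), of b'] less.prems e eC by blast
qed

text \<open>Vertices beyond \<open>c\<close> are all opposite to \<open>c'\<close>. A path in
  \<open>C\<close> from them towards the neighbours of the gate \<open>y\<close> of
  \<open>c'\<close> can leave their set \<open>X\<close> at minimal rank only from \<open>c\<close>
  to another vertex on level two. These two have a common neighbour in \<open>S\<close>, and
  \<open>fan\<close> applies.\<close>

lemma no_opposite_level2:
  assumes c: "c \<in> C" "c' \<in> C" "d s c = 2" "d c c' = d s c + d s c'" and eq: "ln s c = ln s c'"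
  shows False
proof -
  obtain y where y: "y \<in> S" "d s c' = 1 + d y c'" using ex_gate c by blast
  obtain v where v: "v \<in> V" "d s v = 2" "d s c' = 2 + d v c'"
    using geodesic_point[of s c' 2] c d_s_C by auto
  have cv: "d c v = 4"
    using d_tri[of c v c'] d_tri[of c s v] d_sym[of c s] v c by auto
  define X where "X = {z \<in> C. d s z = 2 + d c z}"
  have X_opp: "d z c' = d s z + d s c'" if z: "z \<in> X" for z
  proof -
    have zC: "z \<in> C" "d s z = 2 + d c z" using z X_def by auto
    then have "z \<in> ln s c" using c by (auto simp: mem_line)
    then have "z \<in> ln s c'" using eq by simp
    then consider "d s c' = d s z + d z c'" | "d z c' = d z s + d s c'" | "d s z = d s c' + d c' z"
      by (auto simp: mem_line)
    then show ?thesis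
    proof cases
      case 1 then show ?thesis using d_tri[of c z c'] c zC d_s_C[of c] by auto
    next
      case 2 then show ?thesis using d_sym[of z s] zC by auto
    next
      \<comment> \<open>Here \<open>z\<close> would lie beyond both \<open>c\<close> and
        \<open>v\<close>, which is excluded by \<open>no_common_upper_bound\<close>.\<close>
      case 3
      then have "d s z = 2 + d v z"
        using d_tri[of v c' z] d_tri[of s v z] v c zC by auto
      then show ?thesis using no_common_upper_bound[of s z c v] zC c v cv by auto
    qed
  qed
  let ?T = "{z \<in> C. z \<approx> y}"
  have T: "?T \<subseteq> C" "?T \<noteq> {}" using ex_C[OF y(1)] adj_sym by auto
  obtain \<delta> :: "'a \<Rightarrow> nat" where \<delta>0: "\<And>z. z \<in> C \<Longrightarrow> \<delta> z = 0 \<longleftrightarrow> z \<in> ?T"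
    and \<delta>1: "\<And>z. z \<in> C \<Longrightarrow> \<delta> z \<noteq> 0 \<Longrightarrow> \<exists>w\<in>C. z \<approx> w \<and> Suc (\<delta> w) = \<delta> z"
    and \<delta>2: "\<And>z w. z \<in> C \<Longrightarrow> w \<in> C \<Longrightarrow> z \<approx> w \<Longrightarrow> \<delta> z \<le> Suc (\<delta> w)"
    using conn_rank[OF connC T] by blast
  have "c \<in> X" using c X_def by auto
  then obtain b where b: "b \<in> X" and bmin: "\<And>z. z \<in> X \<Longrightarrow> \<delta> b \<le> \<delta> z"
    using ex_has_least_nat[of "\<lambda>z. z \<in> X" c \<delta>] by blast
  have bC: "b \<in> C" and bl: "d s b = 2 + d c b" using b X_def by auto
  have "\<not> b \<approx> y"
  proof
    assume "b \<approx> y"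
    then have "d b c' \<le> d y c' + 1" using d_adj'[of b y c'] c by auto
    then show False using X_opp[OF b] y bl by auto
  qed
  then have "\<delta> b \<noteq> 0" using \<delta>0 bC by auto
  then obtain b' where b': "b' \<in> C" "b \<approx> b'" "Suc (\<delta> b') = \<delta> b" using \<delta>1 bC by blast
  then have b'X: "b' \<notin> X" using bmin[of b'] by auto
  have up: "z' \<in> X" if z: "z \<in> X" "z' \<approx> z" "z' \<in> C" "d s z' = Suc (d s z)" for z z'
    using z d_adj[of z' z c] d_tri[of s c z'] c unfolding X_def by auto
  have lb: "d s b \<le> d s b' + 1" "d s b' \<le> d s b + 1" "d s b' \<noteq> Suc (d s b)"
    using d_adj[of b b' s] d_adj[of b' b s] up[OF b] b' b'X adj_sym by auto
  \<comment> \<open>Above level two, predecessors of \<open>b\<close> towards \<open>s\<close> stay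
    in \<open>X\<close>, and with \<open>up\<close> so does \<open>b'\<close>.\<close>
  have "d s b = 2"
  proof (rule ccontr)
    assume "d s b \<noteq> 2"
    then have b3: "d s b \<ge> 3" using bl by simp
    have down: "q \<in> X" if q: "q \<approx> b" "Suc (d s q) = d s b" for q
    proof -
      have qC: "q \<in> C" using C_closed[OF bC q(1)] q b3 by auto
      have "d q c' = d s q + d s c'"
        using d_adj'[of b q c'] q adj_sym[of q b] X_opp[OF b] d_tri[of q s c'] d_sym[of q s] qC c by auto
      then have "q \<in> ln s c'" using qC d_sym[of q s] by (auto simp: mem_line)
      then have "q \<in> ln s c" using eq by simp
      then consider "2 = d s q + d q c" | "d q c = d s q + 2" | "d s q = 2 + d c q"
        using c d_sym[of q s] qC by (auto simp: mem_line)
      then show ?thesis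
      proof cases
        case 1
        then have "d s q = 2" "d q c = 0" using d_s_C[OF qC] by auto
        then have "q = c" using d_eq_0 qC c by auto
        then show ?thesis using \<open>c \<in> X\<close> by simp
      next
        case 2
        have "d q c \<le> 1 + d b c" using d_adj'[of q b c] q c by auto
        then show ?thesis using 2 q bl d_sym[of b c] bC c by auto
      next
        case 3 then show ?thesis using X_def qC by auto
      qed
    qed
    show False
    proof (cases "d s b' = d s b")
      case True
      then obtain q where q: "q \<approx> b" "q \<approx> b'" "Suc (d s q) = d s b"
        using triangle[of s b b' "d s b"] b' by auto
      then show False using up[OF down, of q b'] True b' b'X adj_sym by auto
    next
      case False
      then show False using lb down[of b'] b' b'X adj_sym by auto
    qed
  qed
  then have bc: "b = c" using bl d_eq_0[of c b] bC c by auto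
  then have "d s b' = 2" using lb c d_s_C[of b'] b' by auto
  then obtain x where x: "x \<approx> c" "x \<approx> b'" "Suc (d s x) = 2"
    using triangle[of s c b' 2] b' bc c by auto
  have xS: "x \<in> S" using C_nbr_S[OF c(1) x(1)] x by auto
  \<comment> \<open>The route from \<open>c\<close> through \<open>x\<close> and \<open>y\<close> to
    \<open>c'\<close> would be shorter than the one through \<open>s\<close>.\<close>
  have nxy: "\<not> x \<approx> y"
  proof
    assume "x \<approx> y"
    then have "d x c' \<le> 1 + d y c'" using d_adj'[of x y c'] c by auto
    moreover have "d c c' \<le> 1 + d x c'" using d_adj'[of c x c'] x adj_sym c by auto
    ultimately show False using c y by auto
  qed
  show False
  proof (rule fan[OF xS y(1) nxy _ \<delta>1 \<delta>2, of c b'])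
    show "\<And>z. z \<in> C \<Longrightarrow> (\<delta> z = 0) = (z \<approx> y)" using \<delta>0 by auto
  qed (use b' bc c x in auto)
qed

text \<open>Equality makes \<open>s\<close>, \<open>c\<close> and \<open>c'\<close> collinear.
  Nested positions give a universal line; opposite ones are split by level, since
  \<open>no_opposite_far\<close> needs both vertices at distance at least three from
  \<open>s\<close>.\<close>

lemma C_lines_distinct:
  assumes c: "c \<in> C" "c' \<in> C" and eq: "ln s c = ln s c'"
  shows "c = c'"
proof (rule ccontr)
  assume ne: "c \<noteq> c'"
  have "c' \<in> ln s c'" using c by (auto simp: mem_line)
  then have "c' \<in> ln s c" using eq by simp
  then consider "d s c = d s c' + d c' c" | "d c' c = d c' s + d s c" | "d s c' = d s c + d c c'"
    by (auto simp: mem_line)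
  then show False
  proof cases
    case 1 then show False using nested_universal[of s c' c] no_universal ne c eq d_s_C by auto
  next
    case 3 then show False using nested_universal[of s c c'] no_universal ne c eq d_s_C by auto
  next
    case 2
    then have opp: "d c c' = d s c + d s c'" "d c' c = d s c' + d s c"
      using d_sym[of c c'] d_sym[of s c'] c by auto
    consider "d s c = 2" | "d s c' = 2" | "d s c \<ge> 3" "d s c' \<ge> 3"
      using d_s_C[of c] d_s_C[of c'] c by linarith
    then show False
    proof cases
      case 1 then show False using no_opposite_level2[of c c'] c opp eq by auto
    next
      case 2 then show False using no_opposite_level2[of c' c] c opp eq by auto
    next
      case 3 then show False using no_opposite_far[of r s c c' "d r s"] c opp far by auto
    qed
  qed
qed

end


section \<open>Traces of lines on the separator and on \<open>A\<close>\<close>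

context hh_base
begin

lemma S_d2: "x \<in> S \<Longrightarrow> y \<in> S \<Longrightarrow> x \<noteq> y \<Longrightarrow> \<not> x \<approx> y \<Longrightarrow> d x y = 2"
  using d_eq_2[of x s y] s_S adj_sym[of s x] by auto

lemma S_dist: "x \<in> S \<Longrightarrow> y \<in> S \<Longrightarrow> d x y = (if x = y then 0 else if x \<approx> y then 1 else 2)"
  using S_d2 adj_d1 by auto

lemma S_in_sx: "x \<in> S \<Longrightarrow> y \<in> S \<Longrightarrow> y \<in> ln s x \<longleftrightarrow> \<not> x \<approx> y"
  using edge_line[of s x y] s_S[of x] S_dist[of x y] d_s_S[of y] by simp

lemma A_in_sx: "x \<in> S \<Longrightarrow> a \<in> A \<Longrightarrow> a \<in> ln s x \<longleftrightarrow> \<not> s \<approx> a"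
  using edge_line[of s x a] s_S[of x] adj_d1[of a x] A_S[of a x] d_sym[of a x] d_eq_1[of s a] by simp

lemma S_in_sc:
  assumes "v \<in> S" "c \<in> C"
  shows "v \<in> ln s c \<longleftrightarrow> d v c \<noteq> d s c"
proof -
  have sv: "s \<approx> v" "v \<approx> s" using s_S assms adj_sym by blast+
  have "v \<in> V" "d s v = 1" "d v s = 1" "d c v = d v c" "2 \<le> d s c" "d s c \<le> d v c + 1" "d v c \<le> d s c + 1"
    using assms adj_d1[OF sv(1)] adj_d1[OF sv(2)] d_sym[of c v] d_s_C[of c] d_adj'[OF sv(1), of c] d_adj'[OF sv(2), of c]
    by simp_all
  then show ?thesis unfolding mem_line by linarith
qed

text \<open>The trace of \<open>sx\<close> on \<open>S\<close> consists of the nonneighbours of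
  \<open>x\<close>, so equal lines make \<open>x\<close> and \<open>y\<close> nonadjacent twins
  within \<open>S\<close>.\<close>

lemma same_class:
  assumes "x \<in> S" "y \<in> S" "ln s x = ln s y"
  shows same_class_nonadj: "\<not> x \<approx> y" and same_class_nbr: "z \<in> S \<Longrightarrow> x \<approx> z \<longleftrightarrow> y \<approx> z"
  using S_in_sx[OF assms(1,2)] S_in_sx[OF assms(2,2)] S_in_sx[OF assms(1), of z] S_in_sx[OF assms(2), of z] assms(3)
  by simp_all

lemma S_in_xy:
  assumes "x \<in> S" "y \<in> S" "x \<noteq> y" "\<not> x \<approx> y" "z \<in> S"
  shows "z \<in> ln x y \<longleftrightarrow> z = x \<or> z = y \<or> (x \<approx> z \<and> y \<approx> z)"
proof -
  have "d x y = 2" "d x z = (if x = z then 0 else if x \<approx> z then 1 else 2)"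
    "d y z = (if y = z then 0 else if y \<approx> z then 1 else 2)" "d z x = d x z" "d z y = d y z" "z \<in> V"
    using assms S_dist[of x y] S_dist[of x z] S_dist[of y z] d_sym[of z x] d_sym[of z y] by simp_all
  then show ?thesis unfolding mem_line using assms(3,4) by (auto split: if_splits)
qed

lemma S_in_class_pair:
  assumes "x \<in> S" "y \<in> S" "x \<noteq> y" "ln s x = ln s y" "z \<in> S"
  shows "z \<in> ln x y \<longleftrightarrow> z = x \<or> z = y \<or> x \<approx> z"
  using S_in_xy[OF assms(1-3) same_class_nonadj[OF assms(1,2,4)] assms(5)] same_class_nbr[OF assms(1,2,4,5)]
  by simp

lemma A_in_xy:
  assumes "x \<in> S" "y \<in> S" "x \<noteq> y" "\<not> x \<approx> y" "a \<in> A"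
  shows "a \<in> ln x y"
proof -
  have "d x y = 2" "d a x = 1" "d a y = 1" "d x a = 1" "a \<in> V"
    using assms S_d2 adj_d1[OF A_S[OF assms(5,1)]] adj_d1[OF A_S[OF assms(5,2)]] d_sym[of x a] by simp_all
  then show ?thesis by (simp add: mem_line)
qed

lemma A_notin_edge:
  assumes "x \<approx> y" "x \<in> S" "y \<in> S" "a \<in> A"
  shows "a \<notin> ln x y"
  using edge_line[OF assms(1), of a] adj_d1[OF A_S[OF assms(4,2)]] adj_d1[OF A_S[OF assms(4,3)]]
    d_sym[of x a] d_sym[of y a] assms by simp

lemma A_d: "a \<in> A \<Longrightarrow> b \<in> A \<Longrightarrow> d a b \<le> 2"
proof -
  assume ab: "a \<in> A" "b \<in> A"
  obtain x where "x \<in> S" using S_nonempty by blast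
  then show ?thesis using d_le_2[of a x b] A_S ab adj_sym by blast
qed

lemma A_d_C: "a \<in> A \<Longrightarrow> c \<in> C \<Longrightarrow> d a c = d s c"
  using A_dist sA by blast

text \<open>All of \<open>A\<close> is equidistant from \<open>c\<close>, so collinearity with
  \<open>b\<close> different from \<open>a\<close> needs \<open>d a b\<close> to be at least four,
  while \<open>A_d\<close> bounds it by two.\<close>

lemma A_in_ac:
  assumes "a \<in> A" "b \<in> A" "c \<in> C"
  shows "b \<in> ln a c \<longleftrightarrow> b = a"
proof -
  have "b \<in> V" "d a b \<le> 2" "d b a = d a b" "d a c = d s c" "d b c = d s c" "d c b = d s c" "2 \<le> d s c" "d a b = 0 \<longleftrightarrow> a = b"
    using assms A_d[of a b] d_sym[of b a] A_d_C[of a c] A_d_C[of b c] d_sym[of c b] d_s_C[of c] d_eq_0[of a b] by simp_all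
  then show ?thesis unfolding mem_line by (cases "b = a") auto
qed

lemma notA_in_ac: "a \<in> A \<Longrightarrow> c \<in> C \<Longrightarrow> z \<in> V \<Longrightarrow> z \<notin> A \<Longrightarrow> z \<in> ln a c \<longleftrightarrow> z \<in> ln s c"
proof -
  assume a: "a \<in> A" "c \<in> C" "z \<in> V" "z \<notin> A"
  have "d a z = d s z"
  proof (cases "z \<in> C")
    case True then show ?thesis using A_d_C a by blast
  next
    case False
    then have "z \<in> S" using a V_eq by blast
    then show ?thesis using adj_d1 A_S a sA by metis
  qed
  then show ?thesis using A_d_C[of a c] a d_sym[of a z] d_sym[of s z] by (simp add: mem_line)
qed

text \<open>The vertex \<open>a\<close> is read off from the trace on \<open>A\<close>. Outside
  \<open>A\<close> the line does not depend on \<open>a\<close>, so \<open>C_lines_distinct\<close>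
  recovers \<open>c\<close>.\<close>

lemma AC_lines_inj: "inj_on (\<lambda>(a, c). ln a c) (A \<times> C)"
proof (rule inj_onI, clarify)
  fix a c a' c' assume h: "a \<in> A" "c \<in> C" "a' \<in> A" "c' \<in> C" "ln a c = ln a' c'"
  have "a \<in> ln a c" using A_in_ac h by blast
  then have aa: "a = a'" using A_in_ac h by blast
  have "ln s c = ln s c'"
  proof (rule set_eqI)
    fix z
    consider "z \<notin> V" | "z \<in> A" | "z \<in> V" "z \<notin> A" by blast
    then show "z \<in> ln s c \<longleftrightarrow> z \<in> ln s c'"
    proof cases
      case 1 then show ?thesis by (simp add: mem_line)
    next
      case 2 then show ?thesis using A_in_ac[OF sA 2 h(2)] A_in_ac[OF sA 2 h(4)] by simp
    next
      case 3
      then show ?thesis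
        using notA_in_ac[OF h(1,2) 3] notA_in_ac[OF h(3,4) 3] h(5) by simp
    qed
  qed
  then show "a = a' \<and> c = c'" using C_lines_distinct h aa by blast
qed

text \<open>A neighbour of \<open>x\<close> in \<open>C\<close> lies on \<open>sx\<close>, hence on
  \<open>sc\<close>, so its distance to \<open>c\<close> differs from \<open>d s c\<close> by
  exactly two. If \<open>x\<close> is farther from \<open>c\<close> than \<open>s\<close>, a common
  neighbour of \<open>x\<close> and a gate of \<open>c\<close> violates this; if \<open>x\<close> is
  closer, a common neighbour of \<open>x\<close> and \<open>q\<close> does.\<close>

lemma class_S_C_isolated:
  assumes x: "x \<in> S" and c: "c \<in> C" and eq: "ln s x = ln s c" and q: "q \<in> S"
  shows "\<not> x \<approx> q"
proof
  assume xq: "x \<approx> q"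
  have xc: "d x c \<noteq> d s c" using S_in_sc[OF x c] S_in_sx[OF x x] eq by simp
  have bounds: "d s c \<le> d x c + 1" "d x c \<le> d s c + 1"
    using d_adj'[OF s_S[OF x], of c] d_adj'[of x s c] s_S[OF x] adj_sym[of s x] c by simp_all
  have above: "d s c = 2 + d w c \<or> d w c = 2 + d s c" if w: "w \<in> C" "x \<approx> w" for w
  proof -
    have sw: "d s w = 2" using d_le_2[OF s_S[OF x] w(2)] d_s_C[OF w(1)] by simp
    then have "w \<in> ln s x" using edge_line[OF s_S[OF x], of w] adj_d1[OF w(2)] w by simp
    then have "w \<in> ln s c" using eq by simp
    then show ?thesis using sw d_sym[of w s] w d_s_C[OF c] d_sym[of c w] c unfolding mem_line by auto
  qed
  show False
  proof (cases "d x c = d s c + 1")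
    case True
    obtain y where y: "y \<in> S" "d s c = 1 + d y c" using ex_gate[OF c] by blast
    have "x \<noteq> y" using y True by auto
    then obtain w where w: "w \<in> C" "x \<approx> w" "y \<approx> w" using S_common[OF x y(1)] by blast
    have "d x c \<le> d w c + 1" "d w c \<le> d y c + 1"
      using d_adj'[OF w(2), of c] d_adj'[of w y c] w(3) adj_sym[of w y] c by simp_all
    then show False using above[OF w(1,2)] True y(2) by linarith
  next
    case False
    then have xl: "d s c = d x c + 1" using xc bounds by linarith
    have "d q c = d s c" using S_in_sc[OF q c] S_in_sx[OF x q] eq xq by simp
    moreover obtain w where w: "w \<in> C" "x \<approx> w" "q \<approx> w" using S_common[OF x q] xq by fastforce
    moreover have "d q c \<le> d w c + 1" "d w c \<le> d x c + 1"
      using d_adj'[OF w(3), of c] d_adj'[of w x c] w(2) adj_sym[of w x] c by simp_all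
    ultimately show False using above[OF w(1,2)] xl by linarith
  qed
qed

text \<open>Traces on \<open>S\<close> force the line to be \<open>sx\<close> and \<open>x\<close>
  to have no neighbour in \<open>S\<close>. The trace on \<open>A\<close> then leaves the edge
  \<open>sx\<close> in no triangle.\<close>

lemma pair_line_not_S_line:
  assumes x: "x \<in> S" "y \<in> S" "x \<noteq> y" "ln s x = ln s y" and v: "v \<in> S"
  shows "ln x y \<noteq> ln s v"
proof
  assume eq: "ln x y = ln s v"
  have xy: "\<not> x \<approx> y" using same_class_nonadj x by blast
  have vin: "v = x \<or> v = y \<or> x \<approx> v" using S_in_class_pair[OF x v] S_in_sx[OF v v] eq by simp
  have "\<not> x \<approx> v"
  proof
    assume "x \<approx> v"
    then have "x \<notin> ln s v" using S_in_sx[OF v x(1)] adj_sym by blast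
    then show False using S_in_class_pair[OF x x(1)] eq by simp
  qed
  then have sx: "ln x y = ln s x" using vin eq x(4) by auto
  have noq: "\<not> x \<approx> q" if "q \<in> S" for q
    using S_in_class_pair[OF x that] S_in_sx[OF x(1) that] sx by auto
  have S2: "S = {x, y}"
    using S_in_class_pair[OF x] S_in_sx[OF x(1)] sx noq x by blast
  have A1: "\<not> s \<approx> a" if "a \<in> A" for a
    using A_in_sx[OF x(1) that] A_in_xy[OF x(1-3) xy that] sx by simp
  obtain p where p: "p \<approx> s" "p \<approx> x" using edge_in_triangle[OF s_S[OF x(1)]] by blast
  have "p \<in> V" using p adj_inV by blast
  then consider "p \<in> A" | "p \<in> S" | "p \<in> C" using V_eq by blast
  then show False
  proof cases
    case 1 then show False using A1 p adj_sym by blast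
  next
    case 2 then show False using noq p adj_sym by blast
  next
    case 3 then show False using A_C[OF sA] p adj_sym by blast
  qed
qed

text \<open>The right-hand side does not mention \<open>x\<close>, so all such vertices have the
  same line. A vertex of \<open>C\<close> off the line would give \<open>s\<close> and
  \<open>x\<close> a common neighbour closer to it, which cannot lie in \<open>A\<close>, as
  \<open>A\<close> is equidistant from each vertex of \<open>C\<close>.\<close>

lemma S_line_isolated:
  assumes x: "x \<in> S" and noq: "\<And>q. q \<in> S \<Longrightarrow> \<not> x \<approx> q"
  shows "ln s x = S \<union> C \<union> {a \<in> A. \<not> s \<approx> a}"
proof -
  have C: "z \<in> ln s x" if z: "z \<in> C" for z
  proof (rule ccontr)
    assume "z \<notin> ln s x"
    then have "d s z = d x z" using edge_line[OF s_S[OF x], of z] z by simp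
    then have "d z s = d z x" using d_sym[of z s] d_sym[of z x] z x by simp
    then obtain p where p: "p \<approx> s" "p \<approx> x" "Suc (d z p) = d z s"
      using triangle[OF inV(3)[OF z] s_S[OF x] refl] by metis
    have pV: "p \<in> V" using p adj_inV by blast
    then consider "p \<in> A" | "p \<in> S" | "p \<in> C" using V_eq by blast
    then show False
    proof cases
      case 1 then show False using A_d_C[OF 1 z] d_sym[of z p] d_sym[of z s] p(3) z pV by simp
    next
      case 2 then show False using noq p adj_sym by blast
    next
      case 3 then show False using A_C[OF sA] p adj_sym by blast
    qed
  qed
  show ?thesis
  proof (rule set_eqI)
    fix z
    consider "z \<notin> V" | "z \<in> A" | "z \<in> S" | "z \<in> C" using V_eq by blast
    then show "z \<in> ln s x \<longleftrightarrow> z \<in> S \<union> C \<union> {a \<in> A. \<not> s \<approx> a}"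
    proof cases
      case 1 then show ?thesis using SV CV AV by (auto simp: mem_line)
    next
      case 2 then show ?thesis using A_in_sx[OF x 2] disj by blast
    next
      case 3 then show ?thesis using S_in_sx[OF x 3] noq[OF 3] by simp
    next
      case 4 then show ?thesis using C by simp
    qed
  qed
qed

text \<open>As \<open>c\<close> lies on \<open>sa\<close>, hence on \<open>sa'\<close>, its distance
  to \<open>a'\<close> is one or three. In both cases it lies on \<open>aa'\<close>, hence on
  \<open>bb'\<close>; being within distance two of \<open>b\<close> and \<open>b'\<close>, it is
  adjacent to both, which excludes three.\<close>

lemma twins_in_all:
  assumes a: "a \<in> S" "a' \<in> S" "a \<noteq> a'" "ln s a = ln s a'"
    and b: "b \<in> S" "b' \<in> S" "b \<noteq> b'" "ln s b = ln s b'"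
    and eq: "ln a a' = ln b b'" and ab: "a \<approx> b" "a \<approx> b'"
    and c: "c \<in> C" "c \<approx> a"
  shows "c \<approx> a' \<and> c \<approx> b \<and> c \<approx> b'"
proof -
  have d2: "d a a' = 2" "d b b' = 2" 
    using S_d2[OF a(1-3) same_class_nonadj[OF a(1,2,4)]] S_d2[OF b(1-3) same_class_nonadj[OF b(1,2,4)]] by simp_all
  have ab': "a' \<approx> b" "a' \<approx> b'"
    using same_class_nbr[OF a(1,2,4) b(1)] same_class_nbr[OF a(1,2,4) b(2)] ab by simp_all
  have ac: "a \<approx> c" "d a c = 1" using c adj_sym adj_d1 by blast+
  have sc: "d s c = 2" using d_le_2[OF s_S[OF a(1)] ac(1)] d_s_C[OF c(1)] by simp
  then have "c \<in> ln s a" using edge_line[OF s_S[OF a(1)], of c] ac c by simp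
  then have a'c: "d a' c \<noteq> 2" using edge_line[OF s_S[OF a(2)], of c] sc a(4) by simp
  have a'c3: "d a' c \<le> 3"
    using d_tri[of a' a c] d2(1) ac(2) d_sym[of a' a] a(1,2) c(1) by simp
  have bc2: "d b c \<le> 2" "d b' c \<le> 2"
    using d_le_2[of b a c] d_le_2[of b' a c] ab ac adj_sym by blast+
  have "a' \<noteq> c" "b \<noteq> c" "b' \<noteq> c" using a(2) b(1,2) c(1) disj(3) by blast+
  then have nz: "d a' c \<noteq> 0" "d b c \<noteq> 0" "d b' c \<noteq> 0"
    using d_eq_0[of a' c] d_eq_0[of b c] d_eq_0[of b' c] a(2) b(1,2) c(1) by simp_all
  have syms: "d c a = d a c" "d c a' = d a' c" "d c b = d b c" "d c b' = d b' c" "d a' a = d a a'" "d b' b = d b b'" "c \<in> V"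
    using d_sym[of c a] d_sym[of c a'] d_sym[of c b] d_sym[of c b'] d_sym[of a' a] d_sym[of b' b] a(1,2) b(1,2) c(1)
    by simp_all
  have "d a' c = 1 \<or> d a' c = 3" using a'c a'c3 nz by linarith
  then have "c \<in> ln a a'" unfolding mem_line using syms d2(1) ac(2) by (elim disjE) simp_all
  then have "c \<in> ln b b'" using eq by simp
  then have "d b c + d b' c = 2 \<or> d b' c = d b c + 2 \<or> d b c = d b' c + 2"
    unfolding mem_line using syms d2(2) by auto
  then have bc: "d b c = 1" "d b' c = 1" using bc2 nz by linarith+
  then have bb: "b \<approx> c" "b' \<approx> c" using d_eq_1[of b c] d_eq_1[of b' c] b(1,2) c(1) by simp_all
  then have "d a' c \<le> 2" using d_le_2[OF ab'(1) bb(1)] by simp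
  then have "d a' c = 1" using a'c nz by linarith
  then have "a' \<approx> c" using d_eq_1[of a' c] a(2) c(1) by simp
  then show ?thesis using bb adj_sym by blast
qed

section \<open>Coinciding lines to the separator\<close>

text \<open>One vertex of each class of equal lines from \<open>s\<close> keeps that line; the
  others, collected in \<open>nonreps\<close>, need lines of their own.\<close>

definition rep :: "'a \<Rightarrow> 'a" where
  "rep x = (SOME y. y \<in> S \<and> ln s y = ln s x)"

lemma rep: "x \<in> S \<Longrightarrow> rep x \<in> S \<and> ln s (rep x) = ln s x"
  unfolding rep_def by (rule someI_ex) blast

lemma rep_cong: "ln s x = ln s y \<Longrightarrow> rep x = rep y"
  unfolding rep_def by simp

definition nonreps :: "'a set" where "nonreps = {x \<in> S. rep x \<noteq> x}"

definition pair_line :: "'a \<Rightarrow> 'a set" where "pair_line x = ln (rep x) x"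

definition root :: "'a \<Rightarrow> 'a" where
  "root x = (SOME y. y \<in> nonreps \<and> pair_line y = pair_line x)"

lemma nonrepsD:
  assumes "x \<in> nonreps"
  shows "x \<in> S" "rep x \<in> S" "rep x \<noteq> x" "ln s (rep x) = ln s x" "\<not> rep x \<approx> x"
proof -
  show x: "x \<in> S" "rep x \<noteq> x" using assms unfolding nonreps_def by simp_all
  show r: "rep x \<in> S" "ln s (rep x) = ln s x" using rep[OF x(1)] by simp_all
  show "\<not> rep x \<approx> x" by (rule same_class_nonadj[OF r(1) x(1) r(2)])
qed

lemma rep_notin_nonreps: "x \<in> S \<Longrightarrow> rep x \<notin> nonreps"
  using rep[of x] rep_cong[of "rep x" x] unfolding nonreps_def by simp

lemma root: "x \<in> nonreps \<Longrightarrow> root x \<in> nonreps \<and> pair_line (root x) = pair_line x"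
  unfolding root_def by (rule someI_ex) blast

lemma root_cong: "pair_line x = pair_line y \<Longrightarrow> root x = root y"
  unfolding root_def by simp

lemma S_in_pair_line:
  assumes "x \<in> nonreps" "z \<in> S"
  shows "z \<in> pair_line x \<longleftrightarrow> z = rep x \<or> z = x \<or> x \<approx> z"
  using S_in_class_pair[OF nonrepsD(2,1,3,4)[OF assms(1)] assms(2)] same_class_nbr[OF nonrepsD(2,1,4)[OF assms(1)] assms(2)]
  unfolding pair_line_def by simp

lemma A_in_pair_line: "x \<in> nonreps \<Longrightarrow> a \<in> A \<Longrightarrow> a \<in> pair_line x"
  unfolding pair_line_def by (rule A_in_xy[OF nonrepsD(2,1,3,5)])

text \<open>On \<open>S\<close> a pair line consists of the pair and its common neighbours. Two
  pairs with the same line are therefore completely joined.\<close>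

lemma same_pair_line:
  assumes xy: "x \<in> nonreps" "y \<in> nonreps" "x \<noteq> y" "pair_line x = pair_line y"
  shows "x \<approx> y" "x \<approx> rep y" "rep x \<approx> y" "rep x \<approx> rep y" "rep x \<noteq> rep y"
proof -
  have nr: "x \<noteq> rep y" "y \<noteq> rep x" 
    using rep_notin_nonreps[OF nonrepsD(1)[OF xy(2)]] rep_notin_nonreps[OF nonrepsD(1)[OF xy(1)]] xy(1,2) by auto
  show xy': "x \<approx> y"
    using S_in_pair_line[OF xy(1) nonrepsD(1)[OF xy(2)]] S_in_pair_line[OF xy(2) nonrepsD(1)[OF xy(2)]] xy nr by simp
  show "rep x \<approx> y" using same_class_nbr[OF nonrepsD(2,1,4)[OF xy(1)] nonrepsD(1)[OF xy(2)]] xy' by simp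
  show ne: "rep x \<noteq> rep y"
  proof
    assume "rep x = rep y"
    then have "ln s x = ln s y" using nonrepsD(4)[OF xy(1)] nonrepsD(4)[OF xy(2)] by simp
    then show False using same_class_nonadj[OF nonrepsD(1)[OF xy(1)] nonrepsD(1)[OF xy(2)]] xy' by simp
  qed
  show xr: "x \<approx> rep y"
    using S_in_pair_line[OF xy(1) nonrepsD(2)[OF xy(2)]] S_in_pair_line[OF xy(2) nonrepsD(2)[OF xy(2)]] xy nr ne by auto
  show "rep x \<approx> rep y" using same_class_nbr[OF nonrepsD(2,1,4)[OF xy(1)] nonrepsD(2)[OF xy(2)]] xr by simp
qed

text \<open>Apart from the four vertices, \<open>x\<close> and \<open>y\<close> have the same
  neighbours in \<open>S\<close>, namely the rest of the shared pair line.\<close>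

lemma S_in_cross:
  assumes xy: "x \<in> nonreps" "y \<in> nonreps" "x \<noteq> y" "pair_line x = pair_line y" and v: "v \<in> S"
  shows "v \<in> ln x y \<longleftrightarrow> v \<in> {rep x, x, rep y, y}"
proof -
  note p = same_pair_line[OF xy]
  have a: "x \<approx> v \<longleftrightarrow> v \<in> pair_line x \<and> v \<noteq> rep x \<and> v \<noteq> x"
    using S_in_pair_line[OF xy(1) v] nonrepsD(5)[OF xy(1)] adj_sym[of x "rep x"] by auto
  have b: "y \<approx> v \<longleftrightarrow> v \<in> pair_line x \<and> v \<noteq> rep y \<and> v \<noteq> y"
    using S_in_pair_line[OF xy(2) v] nonrepsD(5)[OF xy(2)] adj_sym[of y "rep y"] xy(4) by auto
  have "v \<in> ln x y \<longleftrightarrow> d x v \<noteq> d y v" using edge_line[OF p(1), of v] v by simp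
  also have "d x v = (if x = v then 0 else if x \<approx> v then 1 else 2)" by (rule S_dist[OF nonrepsD(1)[OF xy(1)] v])
  also have "d y v = (if y = v then 0 else if y \<approx> v then 1 else 2)" by (rule S_dist[OF nonrepsD(1)[OF xy(2)] v])
  finally show ?thesis
    using a b p xy(3) nonrepsD(5)[OF xy(1)] nonrepsD(5)[OF xy(2)] adj_sym[of x "rep x"] adj_sym[of y "rep y"] adj_sym[of y x] adj_sym[of y "rep x"]
    by (auto split: if_splits)
qed

end


section \<open>Pair lines that coincide with a line into \<open>C\<close>\<close>

context hh_base
begin

lemma singleton_S_nbr:
  assumes A: "A = {s}" and x: "x \<in> S"
  obtains q where "q \<in> S" "x \<approx> q"
proof -
  obtain p where p: "p \<approx> s" "p \<approx> x" using edge_in_triangle[OF s_S[OF x]] by blast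
  have "p \<in> V" using p adj_inV by blast
  then consider "p \<in> A" | "p \<in> S" | "p \<in> C" using V_eq by blast
  then show ?thesis
  proof cases
    case 1 then show ?thesis using A p by simp
  next
    case 2 then show ?thesis using that p adj_sym by blast
  next
    case 3 then show ?thesis using A_C[OF sA] p adj_sym by blast
  qed
qed

text \<open>The only way in which a pair line can coincide with a line \<open>sz\<close>, \<open>z \<in> C\<close>.\<close>

lemma collision:
  assumes A: "A = {s}" and x: "x \<in> nonreps" and z: "z \<in> C" and eq: "pair_line x = ln s z"
  shows collision_level: "d s z = 2" and collision_x: "z \<approx> x" and collision_rep: "z \<approx> rep x"
    and collision_nbr: "\<And>q. q \<in> S \<Longrightarrow> x \<approx> q \<Longrightarrow> z \<approx> q"
proof -
  note xN = nonrepsD[OF x]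
  obtain q where q: "q \<in> S" "x \<approx> q" using singleton_S_nbr[OF A xN(1)] by blast
  have rq: "rep x \<approx> q" using same_class_nbr[OF xN(2,1,4) q(1)] q(2) by simp
  have in_pl: "x \<in> ln s z" "rep x \<in> ln s z" "q \<in> ln s z"
    using S_in_pair_line[OF x xN(1)] S_in_pair_line[OF x xN(2)] S_in_pair_line[OF x q(1)] q eq by simp_all
  have ne: "d x z \<noteq> d s z" "d (rep x) z \<noteq> d s z" "d q z \<noteq> d s z"
    using in_pl S_in_sc[OF xN(1) z] S_in_sc[OF xN(2) z] S_in_sc[OF q(1) z] by simp_all
  have up: "d v z \<le> d s z + 1" "d s z \<le> d v z + 1" if "v \<in> S" for v
    using d_adj'[of v s z] d_adj'[of s v z] s_S[OF that] adj_sym[of s v] z by simp_all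
  have step: "d x z \<le> d q z + 1" "d q z \<le> d x z + 1" "d (rep x) z \<le> d q z + 1" "d q z \<le> d (rep x) z + 1"
    using d_adj'[of x q z] d_adj'[of q x z] d_adj'[of "rep x" q z] d_adj'[of q "rep x" z]
      q(2) rq adj_sym[of x q] adj_sym[of "rep x" q] z by simp_all
  have d2: "d (rep x) x = 2" using S_d2[OF xN(2,1,3,5)] .
  have "z \<in> ln s z" using z by (simp add: mem_line)
  then have "z \<in> ln (rep x) x" using eq unfolding pair_line_def by simp
  then have z3: "2 = d (rep x) z + d x z \<or> d x z = d (rep x) z + 2 \<or> d (rep x) z = 2 + d x z"
    using d2 d_sym[of z x] d_sym[of z "rep x"] d_sym[of x "rep x"] z xN(1,2) unfolding mem_line by auto
  have "d s z \<ge> 2" by (rule d_s_C[OF z])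
  \<comment> \<open>The vertices \<open>x\<close>, \<open>rep x\<close> and \<open>q\<close> are all
    one step farther from \<open>z\<close> than \<open>s\<close>, or all one step closer. Hence
    \<open>z3\<close> leaves only distance one for \<open>x\<close> and
    \<open>rep x\<close>.\<close>
  then have res: "d s z = 2 \<and> d x z = 1 \<and> d (rep x) z = 1"
    using ne up[OF xN(1)] up[OF xN(2)] up[OF q(1)] step z3 by linarith
  then show lev: "d s z = 2" by simp
  show zx: "z \<approx> x" using res d_eq_1[of x z] xN(1) z adj_sym[of x z] by simp
  show "z \<approx> rep x" using res d_eq_1[of "rep x" z] xN(2) z adj_sym[of "rep x" z] by simp
  fix q' assume q': "q' \<in> S" "x \<approx> q'"
  have "q' \<in> ln s z" using S_in_pair_line[OF x q'(1)] q' eq by simp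
  then have "d q' z \<noteq> 2" using S_in_sc[OF q'(1) z] lev by simp
  moreover have "d q' z \<le> 2" using d_le_2[of q' x z] q' zx adj_sym by blast
  moreover have "d q' z \<noteq> 0" using d_eq_0[of q' z] q'(1) z disj(3) by auto
  ultimately have "d q' z = 1" by linarith
  then show "z \<approx> q'" using d_eq_1[of q' z] q'(1) z adj_sym[of q' z] by simp
qed

context
  fixes x z
  assumes A: "A = {s}" and x: "x \<in> nonreps" and z: "z \<in> C" and eq: "pair_line x = ln s z"
begin

lemmas zx = collision_x[OF A x z eq]
lemmas zr = collision_rep[OF A x z eq]
lemmas zq = collision_nbr[OF A x z eq]
lemmas zl = collision_level[OF A x z eq]

text \<open>The neighbours of \<open>x\<close> in \<open>S\<close> are neighbours of
  \<open>z\<close> too and drop out; vertices of \<open>S\<close> outside the pair line have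
  distance two from both ends.\<close>

lemma S_in_zx:
  assumes v: "v \<in> S" shows "v \<in> ln z x \<longleftrightarrow> v = x \<or> v = rep x"
proof -
  note xN = nonrepsD[OF x]
  have m: "v \<in> ln z x \<longleftrightarrow> d z v \<noteq> d x v" using edge_line[OF zx, of v] v by simp
  have dx: "d x v = (if x = v then 0 else if x \<approx> v then 1 else 2)" by (rule S_dist[OF xN(1) v])
  consider "v = x" | "v = rep x" | "x \<approx> v" | "v \<noteq> x" "v \<noteq> rep x" "\<not> x \<approx> v" by blast
  then show ?thesis
  proof cases
    case 1 then show ?thesis using m adj_d1[OF zx] by simp
  next
    case 2
    then show ?thesis using m adj_d1[OF zr] dx xN(3,5) adj_sym[of "rep x" x] by auto
  next
    case 3
    have "v \<noteq> x" using 3 by auto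
    moreover have "v \<noteq> rep x" using 3 xN(5) adj_sym[of "rep x" x] by auto
    moreover have "d z v = d x v" using adj_d1[OF zq[OF v 3]] adj_d1[OF 3] by simp
    ultimately show ?thesis using m by simp
  next
    case 4
    have "v \<notin> ln s z" using S_in_pair_line[OF x v] 4 eq by simp
    then have "d v z = 2" using S_in_sc[OF v z] zl by simp
    then have "d z v = 2" using d_sym[of v z] v z by simp
    then show ?thesis using m dx 4 by simp
  qed
qed

lemma s_in_zx: "s \<in> ln z x"
  using edge_line[OF zx, of s] zl d_sym[of z s] d_sym[of x s] d_s_S[OF nonrepsD(1)[OF x]] z nonrepsD(1)[OF x] by simp

text \<open>If \<open>z\<close> is all of \<open>C\<close>, the line \<open>sz\<close> is universal.
  Otherwise a neighbour \<open>e\<close> of \<open>z\<close> in \<open>C\<close> refutes the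
  equality.\<close>

lemma zx_ne_sx: "ln z x \<noteq> ln s x"
proof
  assume e: "ln z x = ln s x"
  note xN = nonrepsD[OF x]
  show False
  proof (cases "C = {z}")
    case True
    have "ln s z = V"
    proof
      show "ln s z \<subseteq> V" by (auto simp: mem_line)
      show "V \<subseteq> ln s z"
      proof
        fix v assume "v \<in> V"
        then consider "v \<in> A" | "v \<in> S" | "v \<in> C" using V_eq by blast
        then show "v \<in> ln s z"
        proof cases
          case 1 then show ?thesis using A by (simp add: mem_line)
        next
          case 2
          then have "v \<approx> z" using ex_C[OF 2] True by simp
          then have "d v z = 1" by (rule adj_d1)
          then show ?thesis using S_in_sc[OF 2 z] zl by simp
        next
          case 3 then show ?thesis using True z by (simp add: mem_line)
        qed
      qed
    qed
    moreover have "s \<noteq> z" using sA z disj by blast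
    ultimately show False using no_universal[of s z] z by simp
  next
    case False
    then obtain c where c: "c \<in> C" "c \<noteq> z" using z by blast
    have "(z, c) \<in> (E \<inter> C \<times> C)\<^sup>*" using connC z c unfolding conn_def by blast
    then obtain e where "(z, e) \<in> E \<inter> C \<times> C" using c(2) by (metis converse_rtranclE)
    then have eC: "e \<in> C" and ze: "z \<approx> e" by simp_all
    have ez: "e \<approx> z" using ze adj_sym by blast
    have exn: "e \<noteq> x" "e \<noteq> rep x" using eC xN(1,2) disj by blast+
    have de: "d z e = 1" by (rule adj_d1[OF ze])
    have sle: "d s e \<le> 3" using d_adj[OF ez, of s] zl by simp
    have ex2: "d e x \<le> 2" "d e (rep x) \<le> 2" using d_le_2[OF ez zx] d_le_2[OF ez zr] by simp_all
    have syms: "d x e = d e x" "d (rep x) e = d e (rep x)" "d x (rep x) = 2" "d (rep x) x = 2" "d s z = 2" "d z s = 2" "d e z = 1" "e \<in> V" "d e s = d s e"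
      using d_sym[of x e] d_sym[of "rep x" e] d_sym[of x "rep x"] S_d2[OF xN(2,1,3,5)] zl d_sym[of z s] adj_d1[OF ez] d_sym[of e s] xN(1,2) z eC by simp_all
    have nz: "d e x \<noteq> 0" "d e (rep x) \<noteq> 0" using d_eq_0[of e x] d_eq_0[of e "rep x"] exn xN(1,2) eC by simp_all
    have sC: "d s e \<ge> 2" by (rule d_s_C[OF eC])
    \<comment> \<open>On level three, \<open>e\<close> lies on \<open>sz\<close> but, at distance
      two from \<open>x\<close> and \<open>rep x\<close>, not on the equal pair line. On level two,
      it lies on exactly one of \<open>sx\<close> and \<open>zx\<close>.\<close>
    have pl_iff: "e \<in> ln s z \<longleftrightarrow> 2 = d e (rep x) + d e x \<or> d e x = d e (rep x) + 2 \<or> d e (rep x) = 2 + d e x"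
      unfolding eq[symmetric] pair_line_def mem_line using syms by auto
    have sz_iff: "e \<in> ln s z \<longleftrightarrow> d s e = 3"
      unfolding mem_line using syms de sC sle by auto
    show False
    proof (cases "d s e = 3")
      case True
      then have "d e x \<noteq> 1" "d e (rep x) \<noteq> 1"
        using d_adj[of e x s] d_adj[of e "rep x" s] d_s_S[OF xN(1)] d_s_S[OF xN(2)] d_eq_1[of e x] d_eq_1[of e "rep x"] xN(1,2) eC by auto
      then show False using True sz_iff pl_iff ex2 nz by linarith
    next
      case False
      then have s2: "d s e = 2" using sle sC by linarith
      have mx: "e \<in> ln s x \<longleftrightarrow> d e x \<noteq> 2" using edge_line[OF s_S[OF xN(1)], of e] s2 syms by auto
      have mz: "e \<in> ln z x \<longleftrightarrow> d e x \<noteq> 1" using edge_line[OF zx, of e] de syms by auto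
      have "d e x = 1 \<or> d e x = 2" using ex2 nz by linarith
      then show False using mx mz \<open>ln z x = ln s x\<close> by auto
    qed
  qed
qed

lemma zx_ne_S_line: "v \<in> S \<Longrightarrow> ln z x \<noteq> ln s v"
proof
  assume v: "v \<in> S" and e: "ln z x = ln s v"
  have "v \<in> ln z x" using S_in_sx[OF v v] e by simp
  then have "v = x \<or> v = rep x" using S_in_zx[OF v] by simp
  then have "ln s v = ln s x" using nonrepsD(4)[OF x] by auto
  then show False using e zx_ne_sx by simp
qed

text \<open>A neighbour \<open>q\<close> of \<open>x\<close> in \<open>S\<close> is not on
  \<open>zx\<close>, which would give \<open>d q c = d s c\<close>. But \<open>z\<close> is adjacent
  to \<open>q\<close>, and as a level-two vertex on \<open>sc\<close> its distance to
  \<open>c\<close> would differ from \<open>d s c\<close> by two.\<close>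

lemma zx_ne_C_line: "c \<in> C \<Longrightarrow> ln z x \<noteq> ln s c"
proof
  assume c: "c \<in> C" and e: "ln z x = ln s c"
  obtain q where q: "q \<in> S" "x \<approx> q" using singleton_S_nbr[OF A nonrepsD(1)[OF x]] by blast
  have "q \<noteq> x" "q \<noteq> rep x" using q nonrepsD(5)[OF x] adj_sym[of "rep x" x] by auto
  then have qc: "d q c = d s c" using S_in_zx[OF q(1)] S_in_sc[OF q(1) c] e by simp
  have "z \<in> ln z x" using edge_line[OF zx, of z] adj_d1[OF zx] d_sym[of x z] z nonrepsD(1)[OF x] by simp
  then have "z \<in> ln s c" using e by simp
  then have "d s c = 2 + d z c \<or> d z c = 2 + d s c \<or> 2 = d s c + d c z"
    unfolding mem_line using zl d_sym[of z s] z by auto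
  moreover have "d q c \<le> d z c + 1" "d z c \<le> d q c + 1"
    using d_adj'[of q z c] d_adj'[OF zq[OF q], of c] zq[OF q] adj_sym[of q z] c by simp_all
  moreover have "d c z = d z c" "2 \<le> d s c" using d_sym[of c z] c z d_s_C[OF c] by simp_all
  ultimately show False using qc by linarith
qed

lemma zx_ne_pair_line: "y \<in> nonreps \<Longrightarrow> ln z x \<noteq> pair_line y"
proof
  assume y: "y \<in> nonreps" and e: "ln z x = pair_line y"
  note yN = nonrepsD[OF y] and xN = nonrepsD[OF x]
  have "y \<in> pair_line y" "rep y \<in> pair_line y" using S_in_pair_line[OF y yN(1)] S_in_pair_line[OF y yN(2)] by simp_all
  then have "y = x \<or> y = rep x" using S_in_zx[OF yN(1)] e by simp
  then have yx: "y = x" using rep_notin_nonreps[OF xN(1)] y by auto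
  obtain q where q: "q \<in> S" "x \<approx> q" using singleton_S_nbr[OF A xN(1)] by blast
  have "q \<in> ln z x" using S_in_pair_line[OF y q(1)] q yx e by simp
  then show False using S_in_zx[OF q(1)] q xN(5) adj_sym[of "rep x" x] by auto
qed

end

text \<open>The injection from \<open>S\<close> into the lines. Classes whose members generate the same pair line share one
  \<open>root\<close>, which receives that line; the others are joined to the root. If the pair line is already the
  line \<open>sz\<close> of some \<open>z \<in> C\<close>, the root receives the line \<open>zx\<close> instead.\<close>

definition assigned_line :: "'a \<Rightarrow> 'a set" where
  "assigned_line x = (if rep x = x then ln s x
     else if root x \<noteq> x then ln (root x) x
     else if A = {s} \<and> (\<exists>z\<in>C. pair_line x = ln s z) then ln (SOME z. z \<in> C \<and> pair_line x = ln s z) x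
     else pair_line x)"

lemma assigned_line_cases:
  assumes "x \<in> S"
  obtains (R) "rep x = x" "assigned_line x = ln s x"
  | (E) "x \<in> nonreps" "root x \<in> nonreps" "root x \<noteq> x" "pair_line (root x) = pair_line x" "assigned_line x = ln (root x) x"
  | (Z) z where "x \<in> nonreps" "root x = x" "A = {s}" "z \<in> C" "pair_line x = ln s z" "assigned_line x = ln z x"
  | (P) "x \<in> nonreps" "root x = x" "\<not> (A = {s} \<and> (\<exists>z\<in>C. pair_line x = ln s z))" "assigned_line x = pair_line x"
proof (cases "rep x = x")
  case True then show ?thesis using R unfolding assigned_line_def by simp
next
  case False
  then have xN: "x \<in> nonreps" using assms unfolding nonreps_def by simp
  show ?thesis
  proof (cases "root x = x")
    case rx: False
    show ?thesis by (rule E) (use xN root[OF xN] rx False in \<open>simp_all add: assigned_line_def\<close>)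
  next
    case rx: True
    show ?thesis
    proof (cases "A = {s} \<and> (\<exists>z\<in>C. pair_line x = ln s z)")
      case True
      let ?z = "SOME z. z \<in> C \<and> pair_line x = ln s z"
      have "\<exists>z. z \<in> C \<and> pair_line x = ln s z" using True by blast
      then have "?z \<in> C \<and> pair_line x = ln s ?z" by (rule someI_ex)
      moreover have "assigned_line x = ln ?z x" unfolding assigned_line_def using rx False True by simp
      ultimately show ?thesis using Z[of ?z] xN rx True by blast
    next
      case n: False
      have "assigned_line x = pair_line x" unfolding assigned_line_def using rx n False by auto
      then show ?thesis using P xN rx n by blast
    qed
  qed
qed

text \<open>Lines joining a vertex to its root are generated by edges inside \<open>S\<close> and
  miss \<open>s\<close>; this separates them from the other three kinds.\<close>

lemma s_in_assigned_line:
  assumes "x \<in> S" shows "s \<in> assigned_line x \<longleftrightarrow> \<not> (x \<in> nonreps \<and> root x \<noteq> x)"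
  using assms
proof (cases rule: assigned_line_cases)
  case R
  then have "x \<notin> nonreps" unfolding nonreps_def by simp
  then show ?thesis using R A_in_sx[OF assms sA] by simp
next
  case E
  have "s \<notin> ln (root x) x" using A_notin_edge[OF same_pair_line(1)[OF E(2,1,3,4)] nonrepsD(1)[OF E(2)] nonrepsD(1)[OF E(1)] sA] .
  then show ?thesis using E by simp
next
  case (Z z) then show ?thesis using s_in_zx[OF Z(3,1,4,5)] by simp
next
  case P then show ?thesis using A_in_pair_line[OF P(1) sA] by simp
qed

lemma assigned_line_inj: "inj_on assigned_line S"
proof (rule inj_onI)
  fix x y assume x: "x \<in> S" and y: "y \<in> S" and eq: "assigned_line x = assigned_line y"
  have tE: "(x \<in> nonreps \<and> root x \<noteq> x) \<longleftrightarrow> (y \<in> nonreps \<and> root y \<noteq> y)"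
    using s_in_assigned_line[OF x] s_in_assigned_line[OF y] eq by auto
  have PS: "pair_line u \<noteq> ln s v" if "u \<in> nonreps" "v \<in> S" for u v
    unfolding pair_line_def by (rule pair_line_not_S_line[OF nonrepsD(2,1,3,4)[OF that(1)] that(2)])
  have P2: "u = v" if "root u = u" "root v = v" "pair_line u = pair_line v" for u v
    using root_cong[OF that(3)] that(1,2) by simp
  have nN: "u \<notin> nonreps" if "rep u = u" for u using that unfolding nonreps_def by simp
  show "x = y"
    using x
  proof (cases rule: assigned_line_cases)
    case xR: R
    show ?thesis
      using y
    proof (cases rule: assigned_line_cases)
      case R
      then have "rep x = rep y" using rep_cong[of x y] eq xR by simp
      then show ?thesis using R xR by simp
    next
      case E then show ?thesis using tE nN[OF xR(1)] by simp
    next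
      case (Z z) then show ?thesis using zx_ne_S_line[OF Z(3,1,4,5) x] eq xR by simp
    next
      case P then show ?thesis using PS[OF P(1) x] eq xR by simp
    qed
  next
    case xE: E
    have yE: "y \<in> nonreps" "root y \<noteq> y" using tE xE by simp_all
    have yE': "root y \<in> nonreps" "pair_line (root y) = pair_line y" using root[OF yE(1)] by simp_all
    have "assigned_line y = ln (root y) y" using yE unfolding assigned_line_def nonreps_def by simp
    then have le: "ln (root x) x = ln (root y) y" using eq xE by simp
    have "y \<in> ln (root y) y" using S_in_cross[OF yE'(1) yE(1,2) yE'(2) y] by simp
    then have yin: "y \<in> {rep (root x), root x, rep x, x}"
      using S_in_cross[OF xE(2,1,3,4) y] le by simp
    \<comment> \<open>Among the four vertices, only \<open>x\<close> is neither a representative nor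
      a root.\<close>
    have "y \<noteq> rep (root x)" "y \<noteq> rep x"
      using rep_notin_nonreps[OF nonrepsD(1)[OF xE(2)]] rep_notin_nonreps[OF x] yE(1) by auto
    moreover have "y \<noteq> root x"
    proof
      assume e: "y = root x"
      then have "root y = root x" using root_cong[of "root x" x] xE(4) by simp
      then show False using yE(2) e by simp
    qed
    ultimately show ?thesis using yin by simp
  next
    case xZ: (Z z)
    show ?thesis
      using y
    proof (cases rule: assigned_line_cases)
      case R then show ?thesis using zx_ne_S_line[OF xZ(3,1,4,5) y] eq xZ by simp
    next
      case E then show ?thesis using tE xZ by simp
    next
      case (Z z')
      have "y \<in> ln z' y" using S_in_zx[OF Z(3,1,4,5) y] by simp
      then have "y = x \<or> y = rep x" using S_in_zx[OF xZ(3,1,4,5) y] eq xZ Z by simp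
      then show ?thesis using rep_notin_nonreps[OF x] Z(1) by auto
    next
      case P then show ?thesis using zx_ne_pair_line[OF xZ(3,1,4,5) P(1)] eq xZ by simp
    qed
  next
    case xP: P
    show ?thesis
      using y
    proof (cases rule: assigned_line_cases)
      case R then show ?thesis using PS[OF xP(1) y] eq xP by simp
    next
      case E then show ?thesis using tE xP by simp
    next
      case (Z z) then show ?thesis using zx_ne_pair_line[OF Z(3,1,4,5) xP(1)] eq xP by simp
    next
      case P then show ?thesis using P2[OF xP(2) P(2)] eq xP by simp
    qed
  qed
qed

text \<open>The line \<open>ac\<close> contains exactly one vertex of \<open>A\<close>, whereas
  lines to a root contain none and pair lines contain all of them.\<close>

lemma assigned_line_AC:
  assumes x: "x \<in> S" and a: "a \<in> A" "c \<in> C" and eq: "assigned_line x = ln a c"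
  shows "rep x = x \<and> ln s x = ln s c"
  using x
proof (cases rule: assigned_line_cases)
  case R
  have "s \<in> ln a c" using A_in_sx[OF x sA] R(2) eq by simp
  then have "s = a" using A_in_ac[OF a(1) sA a(2)] by simp
  then show ?thesis using R eq by simp
next
  case E
  have "a \<notin> ln (root x) x" using A_notin_edge[OF same_pair_line(1)[OF E(2,1,3,4)] nonrepsD(1)[OF E(2)] nonrepsD(1)[OF E(1)] a(1)] .
  then show ?thesis using A_in_ac[OF a(1,1,2)] eq E by simp
next
  case (Z z)
  have "a = s" using Z(3) a(1) by simp
  then show ?thesis using zx_ne_C_line[OF Z(3,1,4,5) a(2)] eq Z(6) by simp
next
  case P
  have "b = a" if "b \<in> A" for b using A_in_pair_line[OF P(1) that] A_in_ac[OF a(1) that a(2)] eq P by simp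
  then have "A = {s}" "a = s" using sA by auto
  then show ?thesis using P a(2) eq by auto
qed

lemma assigned_line_is_line: "x \<in> S \<Longrightarrow> assigned_line x \<in> graph_lines V E"
proof -
  have L: "ln u v \<in> graph_lines V E" if "u \<in> V" "v \<in> V" "u \<noteq> v" for u v
    using that unfolding graph_lines_def by blast
  assume x: "x \<in> S"
  then show ?thesis
  proof (cases rule: assigned_line_cases)
    case R
    have "s \<noteq> x" using x sA disj by blast
    then show ?thesis using R L x by simp
  next
    case E then show ?thesis using L[of "root x" x] nonrepsD(1) by simp
  next
    case (Z z)
    have "z \<noteq> x" using x Z(4) disj by blast
    then show ?thesis using L[of z x] x Z by simp
  next
    case P then show ?thesis using L[of "rep x" x] nonrepsD[OF P(1)] unfolding pair_line_def by simp
  qed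
qed

end


section \<open>An additional line and the count\<close>

context hh_base
begin

lemma line_in: "u \<in> V \<Longrightarrow> v \<in> V \<Longrightarrow> u \<noteq> v \<Longrightarrow> ln u v \<in> graph_lines V E"
  unfolding graph_lines_def by blast

text \<open>Otherwise every line missing \<open>s\<close> joins some vertex to its root. This
  confines the edges in \<open>S\<close> to quadruples such as \<open>M\<close>, which has no edges
  to the rest of \<open>S\<close> and whose vertices have the same neighbours in \<open>C\<close>.
  If \<open>S = M\<close>, the lines of edges in \<open>C\<close> give a contradiction; if not, a
  line from \<open>x0\<close> to a vertex outside \<open>M\<close> does.\<close>

lemma extra_line_singleton:
  assumes A: "A = {s}"
  shows "\<exists>l\<in>graph_lines V E. l \<notin> assigned_line ` S \<and> (\<forall>c\<in>C. l \<noteq> ln s c)"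
proof (rule ccontr)
  assume no: "\<not> ?thesis"
  have all: "ln u v \<in> assigned_line ` S \<or> (\<exists>c\<in>C. ln u v = ln s c)" if "u \<in> V" "v \<in> V" "u \<noteq> v" for u v
    using no line_in[OF that] by blast
  have s_sc: "s \<in> ln s c" if "c \<in> C" for c by (simp add: mem_line)
  have avoid: "\<exists>y. y \<in> nonreps \<and> root y \<noteq> y \<and> ln u v = ln (root y) y"
    if uv: "u \<in> V" "v \<in> V" "u \<noteq> v" "s \<notin> ln u v" for u v
  proof -
    have "ln u v \<in> assigned_line ` S" using all[OF uv(1-3)] s_sc uv(4) by auto
    then obtain y where y: "y \<in> S" "ln u v = assigned_line y" by blast
    then have yN: "y \<in> nonreps" "root y \<noteq> y" using s_in_assigned_line[OF y(1)] uv(4) by auto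
    then have "assigned_line y = ln (root y) y" unfolding assigned_line_def nonreps_def by simp
    then show ?thesis using y yN by auto
  qed
  have rtN: "root y \<in> nonreps" "pair_line (root y) = pair_line y" "root (root y) = root y" if "y \<in> nonreps" for y
    using root[OF that] root_cong[of "root y" y] by simp_all
  have cross: "v \<in> ln (root y) y \<longleftrightarrow> v \<in> {rep (root y), root y, rep y, y}" if "y \<in> nonreps" "root y \<noteq> y" "v \<in> S" for y v
    using S_in_cross[OF rtN(1)[OF that(1)] that(1,2) rtN(2)[OF that(1)] that(3)] .
  have edge: "\<exists>y. y \<in> nonreps \<and> root y \<noteq> y \<and> x \<in> {rep (root y), root y, rep y, y} \<and> q \<in> {rep (root y), root y, rep y, y}"
    if xq: "x \<in> S" "q \<in> S" "x \<approx> q" for x q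
  proof -
    have "x \<noteq> q" using xq by auto
    moreover have "s \<notin> ln x q" using A_notin_edge[OF xq(3,1,2) sA] .
    ultimately obtain y where y: "y \<in> nonreps" "root y \<noteq> y" "ln x q = ln (root y) y"
      using avoid[of x q] xq by auto
    have "x \<in> ln x q" "q \<in> ln x q"
      using edge_line[OF xq(3)] adj_d1[OF xq(3)] d_sym[of x q] xq by simp_all
    then show ?thesis using y cross[OF y(1,2) xq(1)] cross[OF y(1,2) xq(2)] by auto
  qed
  obtain w where "w \<in> S" using S_nonempty by blast
  then obtain w' where "w \<in> S" "w' \<in> S" "w \<approx> w'" using singleton_S_nbr[OF A] by blast
  then obtain x1 where x1: "x1 \<in> nonreps" "root x1 \<noteq> x1" using edge by blast
  define x0 where "x0 = root x1"
  have x0: "x0 \<in> nonreps" "pair_line x0 = pair_line x1" "root x0 = x0" "x0 \<noteq> x1" using rtN[OF x1(1)] x1 unfolding x0_def by simp_all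
  note N0 = nonrepsD[OF x0(1)] and N1 = nonrepsD[OF x1(1)]
  note ad = same_pair_line[OF x0(1) x1(1) x0(4,2)]
  define M where "M = {rep x0, x0, rep x1, x1}"
  have MS: "M \<subseteq> S" using N0 N1 unfolding M_def by simp
  have nb0: "v \<in> M" if v: "v \<in> S" "x0 \<approx> v" for v
  proof -
    obtain y where y: "y \<in> nonreps" "root y \<noteq> y" "x0 \<in> {rep (root y), root y, rep y, y}" "v \<in> {rep (root y), root y, rep y, y}"
      using edge[OF N0(1) v] by blast
    have "x0 \<noteq> rep (root y)" "x0 \<noteq> rep y"
      using rep_notin_nonreps[OF nonrepsD(1)[OF rtN(1)[OF y(1)]]] rep_notin_nonreps[OF nonrepsD(1)[OF y(1)]] x0(1) by auto
    moreover have "x0 \<noteq> y" using y(2) x0(3) by auto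
    ultimately have r: "root y = x0" using y(3) by auto
    have "v \<noteq> x0" "v \<noteq> rep x0" using v N0(5) adj_sym[of x0 "rep x0"] by auto
    then have vy: "v = rep y \<or> v = y" using y(4) r by auto
    \<comment> \<open>Otherwise \<open>y\<close> and \<open>x1\<close> are adjacent and lie in one
      quadruple, but a quadruple contains only one vertex that is neither a representative nor a
      root.\<close>
    have "y = x1"
    proof (rule ccontr)
      assume ne: "y \<noteq> x1"
      have "pair_line y = pair_line x1" using rtN(2)[OF y(1)] r x0(2) by simp
      then have "y \<approx> x1" using same_pair_line(1)[OF y(1) x1(1) ne] by simp
      then obtain u where u: "u \<in> nonreps" "root u \<noteq> u" "y \<in> {rep (root u), root u, rep u, u}" "x1 \<in> {rep (root u), root u, rep u, u}"
        using edge[OF nonrepsD(1)[OF y(1)] N1(1)] by blast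
      have nr: "t = u" if t: "t \<in> nonreps" "root t \<noteq> t" "t \<in> {rep (root u), root u, rep u, u}" for t
      proof -
        have "t \<noteq> rep (root u)" "t \<noteq> rep u"
          using rep_notin_nonreps[OF nonrepsD(1)[OF rtN(1)[OF u(1)]]] rep_notin_nonreps[OF nonrepsD(1)[OF u(1)]] t(1) by auto
        moreover have "t \<noteq> root u" using t(2) rtN(3)[OF u(1)] by auto
        ultimately show ?thesis using t(3) by auto
      qed
      show False using nr[OF y(1,2) u(3)] nr[OF x1 u(4)] ne by simp
    qed
    then show ?thesis using vy unfolding M_def by auto
  qed
  have plM: "v \<in> M" if "v \<in> S" "v \<in> pair_line x0" for v
    using S_in_pair_line[OF x0(1) that(1)] that(2) nb0[OF that(1)] unfolding M_def by auto
  have outM: "\<not> m \<approx> v" if m: "m \<in> M" and v: "v \<in> S" "v \<notin> M" for m v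
  proof -
    have n0: "\<not> x0 \<approx> v" using nb0 v by blast
    have n1: "\<not> x1 \<approx> v" using plM[OF v(1)] S_in_pair_line[OF x1(1) v(1)] x0(2) v(2) by auto
    have "\<not> rep x0 \<approx> v" "\<not> rep x1 \<approx> v"
      using n0 n1 same_class_nbr[OF N0(2,1,4) v(1)] same_class_nbr[OF N1(2,1,4) v(1)] by simp_all
    then show ?thesis using n0 n1 m unfolding M_def by auto
  qed
  have eq01: "ln (rep x0) x0 = ln (rep x1) x1" using x0(2) unfolding pair_line_def .
  have swap: "ln x0 (rep x0) = ln (rep x0) x0" "ln x1 (rep x1) = ln (rep x1) x1"
    using ln_sym[of x0 "rep x0"] ln_sym[of x1 "rep x1"] N0(1,2) N1(1,2) by simp_all
  have ad': "x1 \<approx> x0" "x1 \<approx> rep x0" "rep x1 \<approx> x0" "rep x1 \<approx> rep x0" using ad adj_sym by blast+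
  \<comment> \<open>This is \<open>twins_in_all\<close>, started from each of the four vertices of
    \<open>M\<close>.\<close>
  have tw: "c \<approx> m'" if c: "c \<in> C" "c \<approx> m" "m \<in> M" "m' \<in> M" for c m m'
  proof -
    have a: "c \<approx> x0 \<Longrightarrow> c \<approx> rep x0 \<and> c \<approx> rep x1 \<and> c \<approx> x1"
      by (rule twins_in_all[OF N0(1,2) N0(3)[symmetric] N0(4)[symmetric] N1(2,1,3,4) _ ad(2,1) c(1)])
        (use swap eq01 in simp_all)
    have b: "c \<approx> rep x0 \<Longrightarrow> c \<approx> x0 \<and> c \<approx> rep x1 \<and> c \<approx> x1"
      by (rule twins_in_all[OF N0(2,1,3,4) N1(2,1,3,4) eq01 ad(4,3) c(1)])
    have e: "c \<approx> x1 \<Longrightarrow> c \<approx> rep x1 \<and> c \<approx> rep x0 \<and> c \<approx> x0"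
      by (rule twins_in_all[OF N1(1,2) N1(3)[symmetric] N1(4)[symmetric] N0(2,1,3,4) _ ad'(2,1) c(1)])
        (use swap eq01 in simp_all)
    have f: "c \<approx> rep x1 \<Longrightarrow> c \<approx> x1 \<and> c \<approx> rep x0 \<and> c \<approx> x0"
      by (rule twins_in_all[OF N1(2,1,3,4) N0(2,1,3,4) eq01[symmetric] ad'(4,3) c(1)])
    consider "m = x0" | "m = rep x0" | "m = x1" | "m = rep x1" using c(3) unfolding M_def by blast
    then have "c \<approx> x0 \<and> c \<approx> rep x0 \<and> c \<approx> x1 \<and> c \<approx> rep x1"
    proof cases
      case 1 then show ?thesis using a c(2) by blast
    next
      case 2 then show ?thesis using b c(2) by blast
    next
      case 3 then show ?thesis using e c(2) by blast
    next
      case 4 then show ?thesis using f c(2) by blast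
    qed
    then show ?thesis using c(4) unfolding M_def by blast
  qed
  show False
  proof (cases "S = M")
    case True
    \<comment> \<open>The vertex after the gate \<open>y\<close> on a geodesic to \<open>c\<close>
      is adjacent to all of \<open>M\<close>, so every vertex of \<open>S\<close> is a gate for
      \<open>c\<close>.\<close>
    have lev: "d s c = d m c + 1" if c: "c \<in> C" and m: "m \<in> M" for m c
    proof -
      obtain y where y: "y \<in> S" "d s c = 1 + d y c" using ex_gate[OF c] by blast
      have "y \<noteq> c" using y(1) c disj by blast
      then have "d c y \<noteq> 0" using d_eq_0[of c y] y(1) c by auto
      then obtain k where k: "d c y = Suc k" using not0_implies_Suc by blast
      then obtain u where u: "u \<approx> y" "d c u = k" using d_pred[of c y k] c y(1) by auto
      have uV: "u \<in> V" using u adj_inV by blast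
      have syc: "d y c = d c y" "d u c = d c u" using d_sym[of y c] d_sym[of u c] y(1) c uV by simp_all
      have "d s u \<ge> 2" using d_tri[of s u c] uV c y(2) k u(2) syc by simp
      then have "u \<notin> S" "u \<notin> A" using d_s_S[of u] A by auto
      then have "u \<in> C" using uV V_eq by blast
      then have "u \<approx> m" using tw[of u y m] u(1) y(1) True m by simp
      then have "d m c \<le> d u c + 1" using d_adj'[of m u c] adj_sym[of m u] c by simp
      moreover have "d s c \<le> d m c + 1" using d_adj'[OF s_S[of m], of c] m MS c by auto
      ultimately show ?thesis using y(2) syc k u(2) by simp
    qed
    \<comment> \<open>The line of such an edge misses \<open>s\<close>, so it joins some
      \<open>y\<close> to its root and contains \<open>y\<close>; but \<open>lev\<close> makes
      \<open>y\<close> equidistant from \<open>g\<close> and \<open>h\<close>.\<close>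
    have nolev: False if gh: "g \<in> C" "h \<in> C" "g \<approx> h" "d s g = d s h" for g h
    proof -
      have mem: "v \<in> ln g h \<longleftrightarrow> d v g \<noteq> d v h" if "v \<in> V" for v
        using edge_line[OF gh(3), of v] d_sym[of g v] d_sym[of h v] that gh(1,2) by simp
      have "s \<notin> ln g h" using mem gh(4) by simp
      moreover have "g \<noteq> h" using gh(3) by auto
      ultimately obtain y where y: "y \<in> nonreps" "root y \<noteq> y" "ln g h = ln (root y) y"
        using avoid[OF inV(3)[OF gh(1)] inV(3)[OF gh(2)]] by blast
      have yS: "y \<in> S" by (rule nonrepsD(1)[OF y(1)])
      have "y \<in> ln g h" using cross[OF y(1,2) yS] y(3) by simp
      moreover have "d y g = d y h" using lev[OF gh(1), of y] lev[OF gh(2), of y] yS True gh(4) by simp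
      ultimately show False using mem[of y] yS by simp
    qed
    have "\<exists>g\<in>C. \<exists>h\<in>C. g \<approx> h"
    proof (rule ccontr)
      assume ne: "\<not> ?thesis"
      have C1: "C = {r}"
      proof -
        have "c = r" if c: "c \<in> C" for c
        proof (rule ccontr)
          assume "c \<noteq> r"
          moreover have "(r, c) \<in> (E \<inter> C \<times> C)\<^sup>*" using connC rC c unfolding conn_def by blast
          ultimately obtain g where "(r, g) \<in> E \<inter> C \<times> C" by (metis converse_rtranclE)
          then show False using ne by blast
        qed
        then show ?thesis using rC by blast
      qed
      have "v \<in> ln (rep x0) x0" if v: "v \<in> V" for v
      proof -
        consider "v \<in> A" | "v \<in> S" | "v \<in> C" using v V_eq by blast
        then show ?thesis
        proof cases
          case 1 then show ?thesis using A_in_pair_line[OF x0(1)] unfolding pair_line_def by blast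
        next
          case 2
          then have "v = rep x0 \<or> v = x0 \<or> x0 \<approx> v" using True ad unfolding M_def by auto
          then show ?thesis using S_in_pair_line[OF x0(1) 2] unfolding pair_line_def by simp
        next
          case 3
          then have "v = r" using C1 by simp
          then have "rep x0 \<approx> v" "x0 \<approx> v" using ex_C[OF N0(1)] ex_C[OF N0(2)] C1 by auto
          then have "d (rep x0) v = 1" "d v x0 = 1" "d (rep x0) x0 = 2"
            using adj_d1[of "rep x0" v] adj_d1[of v x0] adj_sym[of x0 v] S_d2[OF N0(2,1,3,5)] by simp_all
          then show ?thesis using v by (simp add: mem_line)
        qed
      qed
      then have "ln (rep x0) x0 = V" by (auto simp: mem_line)
      then show False using no_universal[of "rep x0" x0] N0 by simp
    qed
    then obtain g h where gh: "g \<in> C" "h \<in> C" "g \<approx> h" by blast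
    \<comment> \<open>The third vertex of a triangle on the edge \<open>gh\<close> shares a level
      with \<open>g\<close> or with \<open>h\<close>, so \<open>nolev\<close> applies.\<close>
    have key: False if gh: "g \<in> C" "h \<in> C" "g \<approx> h" "d s h = Suc (d s g)" for g h
    proof -
      obtain p where p: "p \<approx> g" "p \<approx> h" using edge_in_triangle[OF gh(3)] by blast
      have ph: "d s h \<le> d s p + 1" "d s p \<le> d s g + 1"
        using d_adj[of h p s] d_adj[OF p(1), of s] p(2) adj_sym[of h p] by simp_all
      have pC: "p \<in> C" using C_closed[OF gh(1) p(1)] ph gh(4) d_s_C[OF gh(1)] by simp
      have "d s p = d s g \<or> d s p = d s h" using ph gh(4) by linarith
      then show False using nolev[OF pC gh(1) p(1)] nolev[OF pC gh(2) p(2)] by blast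
    qed
    have "d s g \<le> d s h + 1" "d s h \<le> d s g + 1"
      using d_adj[OF gh(3), of s] d_adj[of h g s] gh(3) adj_sym[of g h] by simp_all
    then consider "d s g = d s h" | "d s h = Suc (d s g)" | "d s g = Suc (d s h)" by linarith
    then show False
    proof cases
      case 1 then show False using nolev[OF gh] by simp
    next
      case 2 then show False using key[OF gh] by simp
    next
      case 3 then show False using key[OF gh(2,1)] gh(3) adj_sym by blast
    qed
  next
    case False
    then obtain v where v: "v \<in> S" "v \<notin> M" using MS by blast
    have vM: "v \<noteq> x0" "v \<noteq> rep x0" using v unfolding M_def by auto
    have x0M: "x0 \<in> M" "rep x0 \<in> M" unfolding M_def by simp_all
    have x0v: "\<not> x0 \<approx> v" "\<not> rep x0 \<approx> v" using outM[OF _ v] x0M by blast+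
    \<comment> \<open>With only \<open>x0\<close> and \<open>v\<close> from \<open>S\<close>, but
      with \<open>s\<close>, this line fits no kind of assigned line. A line \<open>sc\<close> is
      excluded because it treats the twins \<open>x0\<close> and \<open>rep x0\<close>
      alike.\<close>
    have tr: "u \<in> ln x0 v \<longleftrightarrow> u = x0 \<or> u = v" if u: "u \<in> S" for u
    proof -
      have "\<not> (x0 \<approx> u \<and> v \<approx> u)"
      proof
        assume a: "x0 \<approx> u \<and> v \<approx> u"
        then have "u \<in> M" using nb0 u by blast
        then show False using outM[OF _ v, of u] a adj_sym by blast
      qed
      then show ?thesis using S_in_xy[OF N0(1) v(1) vM(1)[symmetric] x0v(1) u] by blast
    qed
    have rn: "rep x0 \<notin> ln x0 v" using tr[OF N0(2)] N0(3) vM(2) by auto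
    have "ln x0 v \<in> assigned_line ` S \<or> (\<exists>c\<in>C. ln x0 v = ln s c)"
      using all[of x0 v] N0(1) v(1) vM by auto
    then consider y where "y \<in> S" "ln x0 v = assigned_line y" | c where "c \<in> C" "ln x0 v = ln s c" by blast
    then show False
    proof cases
      case (1 y)
      from 1(1) show False
      proof (cases rule: assigned_line_cases)
        case R
        have "y \<in> ln x0 v" using S_in_sx[OF 1(1) 1(1)] 1(2) R(2) by simp
        then have "y = x0 \<or> y = v" using tr[OF 1(1)] by simp
        then have "\<not> y \<approx> rep x0" using N0(5) x0v(2) adj_sym by blast
        then show False using S_in_sx[OF 1(1) N0(2)] rn 1(2) R(2) by simp
      next
        case E
        have "s \<in> ln x0 v" using A_in_xy[OF N0(1) v(1) vM(1)[symmetric] x0v(1) sA] .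
        then show False using s_in_assigned_line[OF 1(1)] E 1(2) by simp
      next
        case (Z z)
        have "rep y \<in> S" using nonrepsD(2)[OF Z(1)] .
        then have "rep y \<in> ln x0 v" "y \<in> ln x0 v"
          using S_in_zx[OF Z(3,1,4,5), of "rep y"] S_in_zx[OF Z(3,1,4,5) 1(1)] 1(2) Z(6) by simp_all
        then have "rep y \<in> {x0, v}" "y \<in> {x0, v}" using tr[OF \<open>rep y \<in> S\<close>] tr[OF 1(1)] by auto
        moreover have "rep y \<noteq> x0" using rep_notin_nonreps[OF 1(1)] x0(1) by auto
        ultimately have "rep y = v" "y = x0" using nonrepsD(3)[OF Z(1)] by auto
        then show False using vM(2) by simp
      next
        case P
        have rS: "rep y \<in> S" using nonrepsD(2)[OF P(1)] .
        have "rep y \<in> ln x0 v" "y \<in> ln x0 v"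
          using S_in_pair_line[OF P(1) rS] S_in_pair_line[OF P(1) 1(1)] 1(2) P(4) by simp_all
        then have "rep y \<in> {x0, v}" "y \<in> {x0, v}" using tr[OF rS] tr[OF 1(1)] by auto
        moreover have "rep y \<noteq> x0" using rep_notin_nonreps[OF 1(1)] x0(1) by auto
        ultimately have "rep y = v" "y = x0" using nonrepsD(3)[OF P(1)] by auto
        then show False using vM(2) by simp
      qed
    next
      case (2 c)
      have x0c: "d x0 c \<noteq> d s c" using tr[OF N0(1)] S_in_sc[OF N0(1) 2(1)] 2(2) by simp
      have rc: "d (rep x0) c = d s c" using rn S_in_sc[OF N0(2) 2(1)] 2(2) by simp
      have sym_nb: "rep x0 \<approx> u" if u: "x0 \<approx> u" for u
      proof -
        have "u \<in> V" using u adj_inV by blast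
        then consider "u \<in> A" | "u \<in> S" | "u \<in> C" using V_eq by blast
        then show ?thesis
        proof cases
          case 1 then show ?thesis using A_S[OF 1 N0(2)] adj_sym by blast
        next
          case 2 then show ?thesis using same_class_nbr[OF N0(2,1,4) 2] u by simp
        next
          case 3 then show ?thesis using tw[OF 3 _ x0M] u adj_sym by blast
        qed
      qed
      have sym_nb': "x0 \<approx> u" if u: "rep x0 \<approx> u" for u
      proof -
        have "u \<in> V" using u adj_inV by blast
        then consider "u \<in> A" | "u \<in> S" | "u \<in> C" using V_eq by blast
        then show ?thesis
        proof cases
          case 1 then show ?thesis using A_S[OF 1 N0(1)] adj_sym by blast
        next
          case 2 then show ?thesis using same_class_nbr[OF N0(2,1,4) 2] u by simp
        next
          case 3 then show ?thesis using tw[OF 3 _ x0M(2,1)] u adj_sym by blast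
        qed
      qed
      have le: "d b c \<le> d a c" if ab: "a \<in> S" "b \<in> S" "\<And>u. a \<approx> u \<Longrightarrow> b \<approx> u" for a b
      proof -
        have "a \<noteq> c" using ab(1) 2(1) disj by blast
        then have "d c a \<noteq> 0" using d_eq_0[of c a] ab(1) 2(1) by auto
        then obtain k where k: "d c a = Suc k" using not0_implies_Suc by blast
        then obtain u where u: "u \<approx> a" "d c u = k" using d_pred[of c a k] ab(1) 2(1) by auto
        then have "b \<approx> u" using ab(3) adj_sym by blast
        then have "d c b \<le> k + 1" using d_adj[of b u c] u(2) 2(1) by simp
        then show ?thesis using k d_sym[of c a] d_sym[of c b] ab(1,2) 2(1) by simp
      qed
      have "d x0 c = d (rep x0) c"
        using le[OF N0(1,2) sym_nb] le[OF N0(2,1) sym_nb'] by simp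
      then show False using x0c rc by simp
    qed
  qed
qed

lemma card_lines: "card V \<le> card (graph_lines V E)"
proof -
  define F where "F = (\<lambda>(a, c). ln a c) ` (A \<times> C)"
  define B where "B = {x \<in> S. assigned_line x \<in> F}"
  have finV: "finite A" "finite S" "finite C" using fin AV SV CV finite_subset by blast+
  have "graph_lines V E \<subseteq> Pow V" unfolding graph_lines_def by (auto simp: mem_line)
  then have finG: "finite (graph_lines V E)" using fin finite_subset finite_Pow_iff by metis
  have cF: "card F = card A * card C"
    unfolding F_def using card_image[OF AC_lines_inj] card_cartesian_product by metis
  have FG: "F \<subseteq> graph_lines V E"
  proof
    fix l assume "l \<in> F"
    then obtain a c where ac: "a \<in> A" "c \<in> C" "l = ln a c" unfolding F_def by auto
    moreover have "a \<noteq> c" using ac disj by blast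
    ultimately show "l \<in> graph_lines V E" using line_in by simp
  qed
  have phG: "assigned_line ` S \<subseteq> graph_lines V E" using assigned_line_is_line by blast
  have Bprop: "rep x = x \<and> (\<exists>c\<in>C. ln s x = ln s c)" if "x \<in> B" for x
  proof -
    obtain a c where "x \<in> S" "a \<in> A" "c \<in> C" "assigned_line x = ln a c" using \<open>x \<in> B\<close> unfolding B_def F_def by auto
    then show ?thesis using assigned_line_AC by blast
  qed
  have Biso: "\<not> x \<approx> q" if "x \<in> B" "q \<in> S" for x q
  proof -
    obtain c where "c \<in> C" "ln s x = ln s c" using Bprop[OF \<open>x \<in> B\<close>] by blast
    then show ?thesis using class_S_C_isolated[of x c q] that unfolding B_def by simp
  qed
  \<comment> \<open>By \<open>Biso\<close> both vertices are isolated in \<open>S\<close>, so their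
    lines from \<open>s\<close> coincide, and both are the representative of the same class.\<close>
  have B1: "x = y" if xy: "x \<in> B" "y \<in> B" for x y
  proof -
    have S: "x \<in> S" "y \<in> S" using xy unfolding B_def by simp_all
    have "ln s x = ln s y"
      using S_line_isolated[OF S(1) Biso[OF xy(1)]] S_line_isolated[OF S(2) Biso[OF xy(2)]] by simp
    then have "rep x = rep y" by (rule rep_cong)
    then show ?thesis using Bprop[OF xy(1)] Bprop[OF xy(2)] by simp
  qed
  have cB: "card B \<le> 1"
    using B1 finV(2) unfolding B_def by (intro card_le_Suc0_iff_eq[THEN iffD2, folded One_nat_def]) auto
  have Ap: "card A \<ge> 1" using sA finV(1) by (metis One_nat_def Suc_leI card_gt_0_iff empty_iff)
  have Cp: "card C \<ge> 1" using rC finV(3) by (metis One_nat_def Suc_leI card_gt_0_iff empty_iff)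
  \<comment> \<open>If \<open>r\<close> is the only vertex of \<open>C\<close>, a triangle on the
    edge \<open>xr\<close> has its third vertex in \<open>S\<close>, against
    \<open>Biso\<close>.\<close>
  have cC2: "card C \<ge> 2" if Bne: "B \<noteq> {}"
  proof (rule ccontr)
    assume "\<not> card C \<ge> 2"
    then have "card C = 1" using Cp by linarith
    then have C1: "C = {r}" using rC card_1_singletonE by (metis singletonD)
    obtain x where x: "x \<in> B" using Bne by blast
    then have xS: "x \<in> S" unfolding B_def by simp
    have xr: "x \<approx> r" using ex_C[OF xS] C1 by simp
    obtain p where p: "p \<approx> x" "p \<approx> r" using edge_in_triangle[OF xr] by blast
    have "p \<in> S \<or> p \<in> C" using C_nbr[OF rC p(2)] .
    then show False using Biso[OF x, of p] p C1 adj_sym[of p x] by auto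
  qed
  have dis: "F \<inter> assigned_line ` (S - B) = {}" unfolding B_def by auto
  have cU: "card (F \<union> assigned_line ` (S - B)) = card A * card C + (card S - card B)"
  proof -
    have "card (assigned_line ` (S - B)) = card (S - B)" using assigned_line_inj by (intro card_image) (auto intro: inj_on_subset)
    moreover have "card (S - B) = card S - card B"
      by (rule card_Diff_subset) (use finV(2) finite_subset[of B S] in \<open>auto simp: B_def\<close>)
    moreover have "finite F" using FG finG finite_subset by blast
    ultimately show ?thesis using card_Un_disjoint[OF _ _ dis] cF finV(2) by simp
  qed
  have extra: "\<exists>l\<in>graph_lines V E. l \<notin> F \<and> l \<notin> assigned_line ` S"
  proof (cases "A = {s}")
    case True
    obtain l where l: "l \<in> graph_lines V E" "l \<notin> assigned_line ` S" "\<forall>c\<in>C. l \<noteq> ln s c"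
      using extra_line_singleton[OF True] by blast
    have "l \<notin> F"
    proof
      assume "l \<in> F"
      then obtain a c where ac: "a \<in> A" "c \<in> C" "l = ln a c" unfolding F_def by auto
      then have "a = s" using True by blast
      then show False using ac l(3) by blast
    qed
    then show ?thesis using l by blast
  next
    case False
    then obtain a where a: "a \<in> A" "a \<noteq> s" using sA by blast
    \<comment> \<open>When \<open>A\<close> has a second vertex \<open>a\<close>, the line
      \<open>sa\<close> is new because it avoids \<open>C\<close>, whereas lines in \<open>F\<close>
      and assigned lines through \<open>s\<close> meet \<open>C\<close>.\<close>
    have noC: "c \<notin> ln s a" if c: "c \<in> C" for c
    proof -
      have "d s a \<le> 2" "d s c = d a c" "d c a = d a c" "d c s = d s c" "d s c \<ge> 2" "d s a \<noteq> 0"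
        using A_d[OF sA a(1)] A_d_C[OF a(1) c] d_sym[of c a] d_sym[of c s] d_s_C[OF c] d_eq_0[of s a] a c by simp_all
      then show ?thesis unfolding mem_line by auto
    qed
    have aa: "s \<in> ln s a" by (simp add: mem_line)
    have "ln s a \<notin> F"
    proof
      assume "ln s a \<in> F"
      then obtain b c where "b \<in> A" "c \<in> C" "ln s a = ln b c" unfolding F_def by auto
      moreover have "c \<in> ln b c" using \<open>c \<in> C\<close> by (simp add: mem_line)
      ultimately show False using noC by auto
    qed
    moreover have "ln s a \<notin> assigned_line ` S"
    proof
      assume "ln s a \<in> assigned_line ` S"
      then obtain x where x: "x \<in> S" "ln s a = assigned_line x" by blast
      obtain c where c: "c \<in> C" "x \<approx> c" using ex_C[OF x(1)] by blast
      from x(1) show False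
      proof (cases rule: assigned_line_cases)
        case R
        have "c \<in> ln s x" using edge_line[OF s_S[OF x(1)], of c] adj_d1[OF c(2)] d_s_C[OF c(1)] c(1) by simp
        then show False using noC[OF c(1)] x(2) R by simp
      next
        case E then show False using s_in_assigned_line[OF x(1)] aa x(2) by simp
      next
        case (Z z) then show False using False by simp
      next
        case P
        note xN = nonrepsD[OF P(1)]
        obtain w where w: "w \<in> C" "rep x \<approx> w" "x \<approx> w" using S_common[OF xN(2,1,3)] by blast
        have "d (rep x) x = 2" "d (rep x) w = 1" "d w x = 1"
          using S_d2[OF xN(2,1,3,5)] adj_d1[OF w(2)] adj_d1[of w x] w(3) adj_sym[of x w] by simp_all
        then have "w \<in> pair_line x" unfolding pair_line_def mem_line using w(1) by simp
        then show False using noC[OF w(1)] x(2) P by simp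
      qed
    qed
    moreover have "ln s a \<in> graph_lines V E" using line_in[of s a] a by simp
    ultimately show ?thesis by blast
  qed
  then obtain l where l: "l \<in> graph_lines V E" "l \<notin> F" "l \<notin> assigned_line ` S" by blast
  let ?U = "insert l (F \<union> assigned_line ` (S - B))"
  have "?U \<subseteq> graph_lines V E" using l FG phG by blast
  then have "card ?U \<le> card (graph_lines V E)" using finG card_mono by blast
  moreover have "card ?U = Suc (card A * card C + (card S - card B))"
    using cU l finV finite_subset[OF FG finG] by (subst card_insert_disjoint) auto
  moreover have "card V = card A + card S + card C"
    using V_eq disj finV card_Un_disjoint[of A S] card_Un_disjoint[of "A \<union> S" C] by (metis Int_Un_distrib2 Un_empty finite_UnI sup_bot.right_neutral)
  moreover have "card A + card C + card B \<le> Suc (card A * card C)"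
  proof -
    obtain p where p: "card A = Suc p" using Ap by (metis Suc_le_D One_nat_def)
    obtain q where q: "card C = Suc q" using Cp by (metis Suc_le_D One_nat_def)
    \<comment> \<open>After substitution this is the remaining inequality. A nonempty
      \<open>B\<close> makes both factors positive: \<open>cC2\<close> handles \<open>q\<close>, and
      for \<open>A = {s}\<close> every vertex of \<open>S\<close> has a neighbour in
      \<open>S\<close>.\<close>
    have "card B \<le> p * q"
    proof (cases "B = {}")
      case False
      have "q \<ge> 1" using cC2[OF False] q by simp
      moreover have "p \<noteq> 0"
      proof
        assume "p = 0"
        then have "A = {s}" using p sA card_1_singletonE by (metis One_nat_def singletonD)
        obtain x where x: "x \<in> B" using False by blast
        then have xS: "x \<in> S" unfolding B_def by simp
        obtain u where "u \<in> S" "x \<approx> u" using singleton_S_nbr[OF \<open>A = {s}\<close> xS] by blast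
        then show False using Biso[OF x] by blast
      qed
      ultimately have "p * q \<ge> 1" by (simp add: Suc_le_eq)
      then show ?thesis using cB by linarith
    qed simp
    then show ?thesis using p q by simp
  qed
  moreover have "card B \<le> card S" using finV(2) by (intro card_mono) (auto simp: B_def)
  ultimately show ?thesis by linarith
qed

end

section \<open>Choice of the extremal pair\<close>

context hh_no_universal
begin

lemma ex_base:
  assumes u0: "u0 \<in> V" "v0 \<in> V" "d u0 v0 \<ge> 2"
  obtains r s C S A where "hh_base V E r s C S A"
proof -
  define D where "D = Max ((\<lambda>(u, v). d u v) ` (V \<times> V))"
  have finVV: "finite ((\<lambda>(u, v). d u v) ` (V \<times> V))" using fin by simp
  have leD: "d u v \<le> D" if "u \<in> V" "v \<in> V" for u v
    unfolding D_def using that finVV by (intro Max_ge) auto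
  have D2: "D \<ge> 2" using leD[OF u0(1,2)] u0(3) by linarith
  have "(\<lambda>(u, v). d u v) ` (V \<times> V) \<noteq> {}" using u0 by auto
  then have "D \<in> (\<lambda>(u, v). d u v) ` (V \<times> V)" unfolding D_def using finVV by (rule Max_in[rotated])
  then obtain r0 s0 where rs0: "r0 \<in> V" "s0 \<in> V" "d r0 s0 = D" by auto
  define U where "U s = {z \<in> V. z \<noteq> s \<and> \<not> s \<approx> z}" for s
  \<comment> \<open>The component of \<open>r\<close> after removal of the closed neighbourhood of
    \<open>s\<close>; its size is maximised over all pairs at distance \<open>D\<close>.\<close>
  define K where "K r s = {z. (r, z) \<in> (E \<inter> U s \<times> U s)\<^sup>*}" for r s
  define P where "P = (\<lambda>(r, s). r \<in> V \<and> s \<in> V \<and> d r s = D)"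
  have KU: "K r s \<subseteq> U s" if "r \<in> U s" for r s
  proof
    fix z assume "z \<in> K r s"
    then have "(r, z) \<in> (E \<inter> U s \<times> U s)\<^sup>*" unfolding K_def by simp
    then show "z \<in> U s" by (induction rule: rtrancl_induct) (use that in auto)
  qed
  have UV: "U s \<subseteq> V" for s unfolding U_def by blast
  have bounded: "card (K (fst p) (snd p)) < Suc (card V)" if p: "P p" for p
  proof -
    have rs: "fst p \<in> V" "snd p \<in> V" "d (fst p) (snd p) = D" using p unfolding P_def by auto
    have "fst p \<noteq> snd p" using rs D2 by auto
    moreover have "\<not> snd p \<approx> fst p" using rs(3) adj_d1[of "fst p" "snd p"] adj_sym[of "fst p" "snd p"] D2 by auto
    ultimately have "fst p \<in> U (snd p)" unfolding U_def using rs by simp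
    then have "K (fst p) (snd p) \<subseteq> V" using KU UV by blast
    then show ?thesis using card_mono[OF fin] by (simp add: le_imp_less_Suc)
  qed
  have "P (r0, s0)" using rs0 unfolding P_def by simp
  then obtain p where p: "P p" and pmax: "\<And>p'. P p' \<Longrightarrow> card (K (fst p') (snd p')) \<le> card (K (fst p) (snd p))"
    using ex_has_greatest_nat[of P "(r0, s0)" "\<lambda>p. card (K (fst p) (snd p))" "Suc (card V)"] bounded by (metis less_imp_le)
  define r where "r = fst p"
  define s where "s = snd p"
  have rs: "r \<in> V" "s \<in> V" "d r s = D" using p unfolding P_def r_def s_def by auto
  define C where "C = K r s"
  define S where "S = {x \<in> V - C. \<exists>c\<in>C. x \<approx> c}"
  define A where "A = V - C - S"
  have mx: "card (K r a) \<le> card C" if "a \<in> V" "d r a = D" for a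
    using pmax[of "(r, a)"] that rs unfolding P_def C_def r_def s_def by simp
  have rsn: "r \<noteq> s" "\<not> s \<approx> r"
    using rs(3) D2 adj_d1[of r s] adj_sym[of r s] by auto
  have rU: "r \<in> U s" unfolding U_def using rs rsn by simp
  have rC: "r \<in> C" unfolding C_def K_def by simp
  have CU: "C \<subseteq> U s" using KU[OF rU] unfolding C_def .
  have CV: "C \<subseteq> V" using CU UV by blast
  have sC: "s \<notin> C" "\<And>c. c \<in> C \<Longrightarrow> \<not> s \<approx> c" using CU unfolding U_def by auto
  have closed: "v \<in> C" if "c \<in> C" "c \<approx> v" "v \<in> U s" for c v
  proof -
    have "(c, v) \<in> E \<inter> U s \<times> U s" using that CU by blast
    then show ?thesis using that(1) unfolding C_def K_def by (auto intro: rtrancl_into_rtrancl)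
  qed
  have reach: "(r, z) \<in> (E \<inter> C \<times> C)\<^sup>*" if "z \<in> C" for z
  proof -
    have "(r, z) \<in> (E \<inter> U s \<times> U s)\<^sup>*" using that unfolding C_def K_def by simp
    then have "(r, z) \<in> (E \<inter> C \<times> C)\<^sup>* \<and> z \<in> C"
    proof (induction rule: rtrancl_induct)
      case base then show ?case using rC by simp
    next
      case (step y z)
      then have "z \<in> C" using closed[of y z] by blast
      then have "(y, z) \<in> E \<inter> C \<times> C" using step by blast
      then show ?case using step \<open>z \<in> C\<close> by (meson rtrancl_into_rtrancl)
    qed
    then show ?thesis by blast
  qed
  have connC: "conn C"
  proof (rule conn_hubI[OF rC])
    have "sym (E \<inter> C \<times> C)" using adj_sym by (auto simp: sym_def)
    then show "(y, r) \<in> (E \<inter> C \<times> C)\<^sup>*" if "y \<in> C" for y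
      using reach[OF that] sym_rtrancl by (metis symD)
  qed
  have Ss: "s \<approx> x" if x: "x \<in> S" for x
  proof (rule ccontr)
    assume n: "\<not> s \<approx> x"
    obtain c where c: "c \<in> C" "x \<approx> c" and xV: "x \<in> V" "x \<notin> C" using x unfolding S_def by blast
    have "x \<noteq> s" using sC(2) c by blast
    then have "x \<in> U s" using n xV unfolding U_def by simp
    then show False using closed[OF c(1)] c(2) adj_sym xV by blast
  qed
  have sA: "s \<in> A"
    unfolding A_def S_def using rs sC by blast
  have far: "d r v \<le> d r s" if "v \<in> V" for v using leD[OF rs(1) that] rs(3) by simp
  \<comment> \<open>If not, \<open>a\<close> is also at distance \<open>D\<close> from
    \<open>r\<close>, and \<open>K r a\<close> contains \<open>C\<close> as well as
    \<open>x\<close>, contrary to the maximal size of \<open>C\<close>.\<close>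
  have "a \<approx> x" if a: "a \<in> A" and x: "x \<in> S" for a x
  proof (rule ccontr)
    assume n: "\<not> a \<approx> x"
    have aV: "a \<in> V" "a \<notin> C" "a \<notin> S" using a unfolding A_def by simp_all
    have aC: "\<not> a \<approx> c" if "c \<in> C" for c using aV that unfolding S_def by blast
    obtain y where y: "y \<in> V - C" "\<exists>c\<in>C. y \<approx> c" "d r a = d r y + d y a"
      using geodesic_crosses_boundary[OF rC CV aV(1,2)] by blast
    have yS: "y \<in> S" using y unfolding S_def by blast
    have "y \<noteq> a" using yS aV by auto
    then have "d y a \<noteq> 0" using d_eq_0[of y a] y(1) aV(1) by simp
    moreover have "D \<le> d r y + 1" using d_adj[OF Ss[OF yS], of r] rs by simp
    ultimately have "d r a \<ge> D" using y(3) by linarith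
    then have "d r a = D" using leD[OF rs(1) aV(1)] by simp
    then have cle: "card (K r a) \<le> card C" using mx aV by blast
    have CUa: "C \<subseteq> U a"
    proof
      fix c assume "c \<in> C"
      then show "c \<in> U a" using aC[of c] aV(2) CV unfolding U_def by auto
    qed
    have "(E \<inter> C \<times> C)\<^sup>* \<subseteq> (E \<inter> U a \<times> U a)\<^sup>*" using CUa by (intro rtrancl_mono) blast
    then have CK: "C \<subseteq> K r a" using reach unfolding K_def by blast
    have "r \<in> U a" using CUa rC by blast
    then have "finite (K r a)" using KU UV fin finite_subset by meson
    then have eq: "K r a = C" using CK cle card_seteq by metis
    obtain c where c: "c \<in> C" "x \<approx> c" and xV: "x \<in> V" "x \<notin> C" using x unfolding S_def by blast
    have "x \<noteq> a" using x aV by auto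
    then have "x \<in> U a" using n xV unfolding U_def by simp
    then have "(c, x) \<in> E \<inter> U a \<times> U a" using c CUa adj_sym by blast
    moreover have "(r, c) \<in> (E \<inter> U a \<times> U a)\<^sup>*" using c(1) eq unfolding K_def by blast
    ultimately have "x \<in> K r a" unfolding K_def by (auto intro: rtrancl_into_rtrancl)
    then show False using eq xV by simp
  qed
  then have "hh_base V E r s C S A"
    by unfold_locales (use CV connC rC S_def A_def sA far in auto)
  then show ?thesis using that by blast
qed

text \<open>In a complete graph every line is a pair of vertices, so three vertices suffice to find
  as many lines as vertices. A third vertex exists because every edge lies in a triangle.\<close>

lemma complete_lines:
  assumes "\<And>u v. u \<in> V \<Longrightarrow> v \<in> V \<Longrightarrow> d u v \<le> 1" and V2: "card V \<ge> 2"
  shows "card V \<le> card (graph_lines V E)"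
proof -
  have adj: "u \<approx> v" if "u \<in> V" "v \<in> V" "u \<noteq> v" for u v
    using assms(1)[OF that(1,2)] d_eq_0[OF that(1,2)] d_eq_1[OF that(1,2)] that(3) by linarith
  have line: "ln u v = {u, v}" if uv: "u \<in> V" "v \<in> V" "u \<noteq> v" for u v
  proof (rule set_eqI)
    fix z
    note a = adj[OF uv]
    show "z \<in> ln u v \<longleftrightarrow> z \<in> {u, v}"
    proof (cases "z \<in> V \<and> z \<noteq> u \<and> z \<noteq> v")
      case True
      then have "d u z = 1" "d v z = 1" using adj_d1 adj uv by metis+
      then show ?thesis using True edge_line[OF a, of z] by simp
    next
      case False
      then show ?thesis using edge_line[OF a, of z] adj_d1[OF a] d_sym[OF uv(1,2)] uv by auto
    qed
  qed
  obtain a b where ab: "a \<in> V" "b \<in> V" "a \<noteq> b"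
    using V2 card_le_Suc0_iff_eq[OF fin] by (metis One_nat_def Suc_1 not_less_eq_eq)
  obtain c where c: "c \<approx> a" "c \<approx> b" using edge_in_triangle[OF adj[OF ab]] by blast
  have cV: "c \<in> V" "c \<noteq> a" "c \<noteq> b" using c adj_inV by auto
  \<comment> \<open>The pairs through \<open>a\<close> give one line for each other vertex, and
    \<open>{b, c}\<close> is the line for \<open>a\<close> itself.\<close>
  let ?f = "\<lambda>v. if v = a then {b, c} else {a, v}"
  have "inj_on ?f V" using ab cV by (auto simp: inj_on_def doubleton_eq_iff)
  moreover have "?f ` V \<subseteq> graph_lines V E"
  proof
    fix l assume "l \<in> ?f ` V"
    then obtain v where v: "v \<in> V" "l = ?f v" by blast
    have L: "{u, w} \<in> graph_lines V E" if "u \<in> V" "w \<in> V" "u \<noteq> w" for u w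
      using line[OF that] that unfolding graph_lines_def by blast
    show "l \<in> graph_lines V E" using v L[of b c] L[of a v] ab cV by auto
  qed
  moreover have "graph_lines V E \<subseteq> Pow V" unfolding graph_lines_def by (auto simp: mem_line)
  then have "finite (graph_lines V E)" using fin finite_subset finite_Pow_iff by metis
  ultimately show ?thesis using card_inj_on_le by blast
qed

end

theorem theorem1:
  fixes V :: "'a set" and E :: "'a rel"
  assumes "finite V"
    and "card V \<ge> 2"
    and "simple_graph V E"
    and "connected_graph V E"
    and "\<not> has_induced_house V E"
    and "\<not> has_induced_hole V E"
  shows "V \<in> graph_lines V E \<or> card (graph_lines V E) \<ge> card V"
proof (cases "V \<in> graph_lines V E")
  case False
  then have nu: "graph_line V E u v \<noteq> V" if "u \<in> V" "v \<in> V" "u \<noteq> v" for u v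
    using that unfolding graph_lines_def by fastforce
  interpret hh_no_universal V E
    by unfold_locales (use assms nu in auto)
  show ?thesis
  proof (cases "\<exists>u\<in>V. \<exists>v\<in>V. d u v \<ge> 2")
    case True
    then obtain r s C S A where "hh_base V E r s C S A" using ex_base by blast
    then have "card V \<le> card (graph_lines V E)" by (rule hh_base.card_lines)
    then show ?thesis by simp
  next
    case False
    then have "d u v \<le> 1" if "u \<in> V" "v \<in> V" for u v using that by fastforce
    then show ?thesis using complete_lines assms(2) by blast
  qed
qed simp

end
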